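(* Let $f:\subseteq\{0,1\}^\omega\to\{0,1\}^\omega$ be partial computable with $\mu(f^{-1}(\mathsf{ML}))>0$, where $\mathsf{ML}$ is the class of Martin-Löf random reals. Then $f$ has a positive inversion which is computable in $\emptyset''$, i.e. there is a partial $\emptyset''$-computable $g:\subseteq\{0,1\}^\omega\to\{0,1\}^\omega$ with $\mu(\{y: f(g(y))=y\})>0$.
   Context: Reals are elements of $\{0,1\}^\omega$ and $\mu$ is the uniform measure. $\emptyset''$ is the double Turing jump of the empty set. For a real $w$, a partial function $g:\subseteq\{0,1\}^\omega\to\{0,1\}^\omega$ is partial $w$-computable if there is an oracle Turing functional $\Phi$ such that for every $x$: $x\in\mathrm{dom}(g)$ iff $\Phi^{x\oplus w}(n)\downarrow$ for all $n$; and if $x\in\mathrm{dom}(g)$ then $\Phi^{x\oplus w}(n)=g(x)(n)$ for all $n$. Here $x\oplus w$ is the real $z$ with $z(2n)=x(n)$, $z(2n+1)=w(n)$. Partial computable is the case of no additional oracle. The equation $f(g(y))=y$ includes the assertion that $g(y)$ is defined and in $\mathrm{dom}(f)$. $f^{-1}(\mathsf{ML})=\{x\in\mathrm{dom}(f): f(x)\in\mathsf{ML}\}$. *)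

theory Defs
  imports "HOL-Probability.Probability" "HOL-Library.Nat_Bijection"
begin

type_synonym cantor = "nat \<Rightarrow> bool"

text \<open>
  The product sigma-algebra is the Borel sigma-algebra of Cantor space. \<^const>\<open>Sigma_Algebra.measure\<close>
  is 0 on sets outside it, but the domains of partial computable functions, the preimages of Borel
  sets under them, and the components of Martin-Loef tests are all Borel.
\<close>

definition coin_measure :: "cantor measure" where
  "coin_measure = PiM UNIV (\<lambda>_. uniform_count_measure UNIV)"

definition empty_real :: cantor where
  "empty_real = (\<lambda>_. False)"

definition join :: "cantor \<Rightarrow> cantor \<Rightarrow> cantor" where
  "join x w = (\<lambda>n. if even n then x (n div 2) else w (n div 2))"

text \<open>
  Programs for oracle Turing functionals, presented as partial recursive functionals: the
  initial functions together with queries to the oracle, closed under composition, primitive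
  recursion and unbounded search. All functions are unary; several arguments are passed through
  the pairing bijection \<^const>\<open>prod_encode\<close>, with \<open>PairP\<close> forming pairs and \<open>FstP\<close>, \<open>SndP\<close>
  taking them apart.
\<close>

datatype prog =
    ZeroP
  | SuccP
  | FstP
  | SndP
  | OracleP
  | PairP prog prog
  | CompP prog prog
  | RecP prog prog
  | MuP prog

text \<open>
  \<open>run A p\<close> is the partial function on the natural numbers computed by \<open>p\<close> with oracle \<open>A\<close>;
  the value \<^const>\<open>None\<close> means divergence. With \<open>(a, n)\<close> for the code of a pair, \<open>RecP p q\<close>
  computes \<open>h (a, 0) = p a\<close>, \<open>h (a, n + 1) = q (a, (n, h (a, n)))\<close>, and \<open>MuP p\<close> maps \<open>a\<close> to
  the least \<open>n\<close> with \<open>p (a, n) = 0\<close>, provided that \<open>p (a, m)\<close> converges for all \<open>m < n\<close>,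
  and diverges if there is no such \<open>n\<close>.
\<close>

primrec run :: "cantor \<Rightarrow> prog \<Rightarrow> nat \<Rightarrow> nat option" where
  "run A ZeroP = (\<lambda>a. Some 0)"
| "run A SuccP = (\<lambda>a. Some (Suc a))"
| "run A FstP = (\<lambda>a. Some (fst (prod_decode a)))"
| "run A SndP = (\<lambda>a. Some (snd (prod_decode a)))"
| "run A OracleP = (\<lambda>a. Some (of_bool (A a)))"
| "run A (PairP p q) = (\<lambda>a.
     Option.bind (run A p a) (\<lambda>y.
     Option.bind (run A q a) (\<lambda>z. Some (prod_encode (y, z)))))"
| "run A (CompP p q) = (\<lambda>a. Option.bind (run A q a) (run A p))"
| "run A (RecP p q) = (\<lambda>b. case prod_decode b of (a, n) \<Rightarrow>
     rec_nat (run A p a)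
       (\<lambda>m r. Option.bind r (\<lambda>y. run A q (prod_encode (a, prod_encode (m, y))))) n)"
| "run A (MuP p) = (\<lambda>a.
     let found = (\<lambda>n. run A p (prod_encode (a, n)) = Some 0 \<and>
                      (\<forall>m<n. \<exists>k. run A p (prod_encode (a, m)) = Some (Suc k)))
     in if \<exists>n. found n then Some (LEAST n. found n) else None)"

definition halts :: "cantor \<Rightarrow> prog \<Rightarrow> nat \<Rightarrow> bool" where
  "halts A p n \<longleftrightarrow> run A p n \<noteq> None"

primrec index :: "prog \<Rightarrow> nat" where
  "index ZeroP = 0"
| "index SuccP = 1"
| "index FstP = 2"
| "index SndP = 3"
| "index OracleP = 4"
| "index (PairP p q) = 5 + 4 * prod_encode (index p, index q)"
| "index (CompP p q) = 6 + 4 * prod_encode (index p, index q)"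
| "index (RecP p q) = 7 + 4 * prod_encode (index p, index q)"
| "index (MuP p) = 8 + 4 * index p"

lemma bij_index: "bij index"
proof (rule bijI)
  have "index p = index q \<Longrightarrow> p = q" for p q
  proof (induction p arbitrary: q)
    case (PairP p1 p2) then show ?case by (cases q) (simp_all, presburger+)
  next
    case (CompP p1 p2) then show ?case by (cases q) (simp_all, presburger+)
  next
    case (RecP p1 p2) then show ?case by (cases q) (simp_all, presburger+)
  next
    case (MuP p) then show ?case by (cases q) (simp_all, presburger+)
  qed (case_tac [!] q, simp_all)
  then show "inj index" by (rule injI)
  have "\<exists>p. index p = n" for n
  proof (induction n rule: less_induct)
    case (less n)
    show ?case
    proof (cases "n < 5")
      case True
      then have "n = 0 \<or> n = 1 \<or> n = 2 \<or> n = 3 \<or> n = 4" by linarith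
      then show ?thesis by (metis index.simps(1-5))
    next
      case False
      define k where "k = (n - 5) div 4"
      have n: "n = 5 + 4 * k \<or> n = 6 + 4 * k \<or> n = 7 + 4 * k \<or> n = 8 + 4 * k"
        using False unfolding k_def by presburger
      obtain i j where ij: "k = prod_encode (i, j)"
        by (metis prod_decode_inverse surj_pair)
      have "i < n" "j < n" "k < n"
        using n le_prod_encode_1[of i j] le_prod_encode_2[of j i] ij by auto
      then obtain p q r where "index p = i" "index q = j" "index r = k"
        using less by meson
      with n ij show ?thesis
        by (metis index.simps(6-9))
    qed
  qed
  then show "surj index" by (metis surjI)
qed

text \<open>By the bijectivity of \<^const>\<open>index\<close>, every \<open>e\<close> is the index of exactly one program.\<close>

definition jump :: "cantor \<Rightarrow> cantor" where
  "jump A = (\<lambda>e. \<exists>p. index p = e \<and> halts A p e)"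

definition partial_computable :: "(cantor \<rightharpoonup> cantor) \<Rightarrow> bool" where
  "partial_computable g \<longleftrightarrow> (\<exists>p. \<forall>x.
     (x \<in> dom g \<longleftrightarrow> (\<forall>n. halts x p n)) \<and>
     (x \<in> dom g \<longrightarrow> (\<forall>n. run x p n = Some (of_bool (the (g x) n)))))"

definition partial_computable_in :: "cantor \<Rightarrow> (cantor \<rightharpoonup> cantor) \<Rightarrow> bool" where
  "partial_computable_in w g \<longleftrightarrow> (\<exists>p. \<forall>x.
     (x \<in> dom g \<longleftrightarrow> (\<forall>n. halts (join x w) p n)) \<and>
     (x \<in> dom g \<longrightarrow> (\<forall>n. run (join x w) p n = Some (of_bool (the (g x) n)))))"

definition comp_enumerable :: "nat set \<Rightarrow> bool" where
  "comp_enumerable W \<longleftrightarrow> (\<exists>p. W = {n. halts empty_real p n})"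

definition cylinder :: "bool list \<Rightarrow> cantor set" where
  "cylinder s = {x. \<forall>i<length s. x i = s ! i}"

definition string_code :: "bool list \<Rightarrow> nat" where
  "string_code s = list_encode (map of_bool s)"

text \<open>A Martin-Loef test is a uniformly c.e. sequence of open sets of measure at most \<open>1 / 2 ^ n\<close>.\<close>

definition mltest :: "(nat \<Rightarrow> cantor set) \<Rightarrow> bool" where
  "mltest U \<longleftrightarrow>
     (\<exists>W. comp_enumerable W \<and>
       (\<forall>n. U n = (\<Union>s \<in> {s. prod_encode (n, string_code s) \<in> W}. cylinder s))) \<and>
     (\<forall>n. measure coin_measure (U n) \<le> 1 / 2 ^ n)"

definition MLrandom :: "cantor set" where
  "MLrandom = {x. \<forall>U. mltest U \<longrightarrow> x \<notin> (\<Inter>n. U n)}"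

end

theory Submission
  imports Defs
begin

text \<open>
  Let \<open>p\<close> compute \<open>f\<close> and let \<open>A\<close> be the set of inputs with Martin-Loef random image. There are two parts.

  First, the image of every compact set that exhausts enough of the domain has positive measure. Otherwise
  there are clopen sets of arbitrarily small measure that receive a fixed large measure of inputs, and such clopen
  sets can be found computably. They form a test, and the set of inputs whose images are caught infinitely
  often is so large that it meets \<open>A\<close>. The domain being partial is handled by fixing \<open>N\<close> such that the set of
  inputs for which \<open>N\<close> bits of output appear is hardly larger than the domain, and by admitting only clopen sets
  described by at least \<open>N\<close> bits (\<open>no_small_images\<close>, \<open>positive_measure_image\<close>).

  Secondly, one jump of the empty set computes, for each \<open>n\<close>, a bound within which the first \<open>n\<close> bits of output appear on
  nearly all inputs for which they appear at all. These bounds define a compact set \<open>K\<close> inside the domain.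
  For a string \<open>a\<close>, the image of the part of \<open>K\<close> above \<open>a\<close> is a decreasing
  intersection of clopen sets computable in one jump, and a second jump finds a member of this sequence
  whose excess measure is as small as desired (\<open>computable_in_jump_settling_time\<close> serves both purposes). If the excesses are
  summably small, then with the exception of a set of small measure, each \<open>y\<close> in the image of \<open>K\<close> has its membership in
  the image of every part correctly decided by these clopen sets. Hence the leftmost preimage of
  \<open>y\<close> in \<open>K\<close> can be computed from \<open>y\<close> and the second jump, without taking a jump of \<open>y\<close> (\<open>outputs_leftmost\<close>).
\<close>

section \<open>Functions computed uniformly on a class of oracles\<close>

text \<open>
  A single program has to serve all oracles of the class \<open>S\<close>. This one notion covers plain computability
  (\<open>S\<close> a singleton) and functionals such as \<open>y \<mapsto> g y\<close>, for which \<open>S\<close> consists of the oracles \<open>join y Z\<close>.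
\<close>

definition computable_on :: "cantor set \<Rightarrow> (cantor \<Rightarrow> nat \<Rightarrow> nat) \<Rightarrow> bool" where
  "computable_on S F \<longleftrightarrow> (\<exists>p. \<forall>A\<in>S. \<forall>n. run A p n = Some (F A n))"

abbreviation decidable_on :: "cantor set \<Rightarrow> (cantor \<Rightarrow> nat \<Rightarrow> bool) \<Rightarrow> bool" where
  "decidable_on S P \<equiv> computable_on S (\<lambda>A x. of_bool (P A x))"

abbreviation fst_code :: "nat \<Rightarrow> nat" where
  "fst_code z \<equiv> fst (prod_decode z)"

abbreviation snd_code :: "nat \<Rightarrow> nat" where
  "snd_code z \<equiv> snd (prod_decode z)"

text \<open>
  Closure rules for functions written as ordinary expressions. A rule for a construct that binds a
  variable, such as a bounded sum, has a premise in which the bound variable and the argument are the two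
  components of a coded pair, so that repeated introduction reduces every goal to variables and constants.
\<close>

named_theorems computable

lemma computable_onI: "(\<And>A n. A \<in> S \<Longrightarrow> run A p n = Some (F A n)) \<Longrightarrow> computable_on S F"
  unfolding computable_on_def by blast

lemma computable_on_cong:
  assumes "computable_on S F" "\<And>A n. A \<in> S \<Longrightarrow> F A n = G A n"
  shows "computable_on S G"
  using assms unfolding computable_on_def by (metis (no_types, lifting))

primrec const_prog :: "nat \<Rightarrow> prog" where
  "const_prog 0 = ZeroP"
| "const_prog (Suc k) = CompP SuccP (const_prog k)"

lemma run_const_prog [simp]: "run A (const_prog k) n = Some k"
  by (induction k) simp_all

lemma computable_on_const [computable]: "computable_on S (\<lambda>A x. k)"
  by (rule computable_onI[where p = "const_prog k"]) simp

lemma computable_on_id [computable]: "computable_on S (\<lambda>A x. x)"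
  by (rule computable_onI[where p = "PairP FstP SndP"]) simp

lemma computable_on_comp:
  assumes "computable_on S F" "computable_on S a"
  shows "computable_on S (\<lambda>A x. F A (a A x))"
proof -
  from assms obtain p q where "\<forall>A\<in>S. \<forall>n. run A p n = Some (F A n)" "\<forall>A\<in>S. \<forall>n. run A q n = Some (a A n)"
    unfolding computable_on_def by blast
  then show ?thesis
    by (intro computable_onI[where p = "CompP p q"]) simp
qed

lemma computable_on_Suc [computable]:
  "computable_on S a \<Longrightarrow> computable_on S (\<lambda>A x. Suc (a A x))"
  by (rule computable_on_comp[where F = "\<lambda>A. Suc"]) (rule computable_onI[where p = SuccP], simp)

lemma computable_on_fst_code [computable]:
  "computable_on S a \<Longrightarrow> computable_on S (\<lambda>A x. fst_code (a A x))"
  by (rule computable_on_comp[where F = "\<lambda>A. fst_code"]) (rule computable_onI[where p = FstP], simp)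

lemma computable_on_snd_code [computable]:
  "computable_on S a \<Longrightarrow> computable_on S (\<lambda>A x. snd_code (a A x))"
  by (rule computable_on_comp[where F = "\<lambda>A. snd_code"]) (rule computable_onI[where p = SndP], simp)

lemma computable_on_oracle [computable]:
  "computable_on S a \<Longrightarrow> computable_on S (\<lambda>A x. of_bool (A (a A x)))"
  by (rule computable_on_comp[where F = "\<lambda>A n. of_bool (A n)"])
     (rule computable_onI[where p = OracleP], simp)

lemma computable_on_pair [computable]:
  assumes "computable_on S a" "computable_on S b"
  shows "computable_on S (\<lambda>A x. prod_encode (a A x, b A x))"
proof -
  from assms obtain p q where "\<forall>A\<in>S. \<forall>n. run A p n = Some (a A n)" "\<forall>A\<in>S. \<forall>n. run A q n = Some (b A n)"
    unfolding computable_on_def by blast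
  then show ?thesis
    by (intro computable_onI[where p = "PairP p q"]) simp
qed

lemma computable_on_comp2:
  assumes "computable_on S (\<lambda>A z. F A (fst_code z) (snd_code z))"
    and "computable_on S a" "computable_on S b"
  shows "computable_on S (\<lambda>A x. F A (a A x) (b A x))"
  using computable_on_comp[OF assms(1) computable_on_pair[OF assms(2,3)]] by simp

lemma computable_on_comp3:
  assumes "computable_on S (\<lambda>A z. F A (fst_code z) (fst_code (snd_code z)) (snd_code (snd_code z)))"
    and "computable_on S a" "computable_on S b" "computable_on S c"
  shows "computable_on S (\<lambda>A x. F A (a A x) (b A x) (c A x))"
  using computable_on_comp[OF assms(1)
      computable_on_pair[OF assms(2) computable_on_pair[OF assms(3,4)]]] by simp

lemma computable_on_rec [computable]:
  assumes "computable_on S a"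
    and "computable_on S (\<lambda>A z. h A (fst_code z) (fst_code (snd_code z)) (snd_code (snd_code z)))"
    and "computable_on S b"
  shows "computable_on S (\<lambda>A x. rec_nat (a A x) (h A x) (b A x))"
proof -
  from assms(1,2) obtain p q where p: "\<forall>A\<in>S. \<forall>n. run A p n = Some (a A n)"
    and q: "\<forall>A\<in>S. \<forall>n. run A q n = Some (h A (fst_code n) (fst_code (snd_code n)) (snd_code (snd_code n)))"
    unfolding computable_on_def by blast
  have "run A (RecP p q) z = Some (rec_nat (a A (fst_code z)) (h A (fst_code z)) (snd_code z))"
    if "A \<in> S" for A z
  proof -
    have "rec_nat (run A p x)
       (\<lambda>m r. Option.bind r (\<lambda>y. run A q (prod_encode (x, prod_encode (m, y))))) n
       = Some (rec_nat (a A x) (h A x) n)" for x n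
      using p q that by (induction n) simp_all
    then show ?thesis by (simp add: case_prod_beta)
  qed
  then have "computable_on S (\<lambda>A z. rec_nat (a A (fst_code z)) (h A (fst_code z)) (snd_code z))"
    by (rule computable_onI)
  from computable_on_comp[OF this computable_on_pair[OF computable_on_id assms(3)]]
  show ?thesis by simp
qed

lemma computable_on_add [computable]:
  assumes "computable_on S a" "computable_on S b"
  shows "computable_on S (\<lambda>A x. a A x + b A x)"
proof -
  have "m + n = rec_nat m (\<lambda>_ r. Suc r) n" for m n
    by (induction n) simp_all
  then show ?thesis by (simp only:) (intro computable assms)
qed

lemma computable_on_diff [computable]:
  assumes "computable_on S a" "computable_on S b"
  shows "computable_on S (\<lambda>A x. a A x - b A x)"
proof -
  have pred: "n - 1 = rec_nat 0 (\<lambda>m r. m) n" for n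
    by (cases n) simp_all
  have "m - n = rec_nat m (\<lambda>_ r. rec_nat 0 (\<lambda>m r. m) r) n" for m n
    by (induction n) (simp_all flip: pred)
  then show ?thesis by (simp only:) (intro computable assms)
qed

lemma computable_on_mult [computable]:
  assumes "computable_on S a" "computable_on S b"
  shows "computable_on S (\<lambda>A x. a A x * b A x)"
proof -
  have "m * n = rec_nat 0 (\<lambda>_ r. r + m) n" for m n :: nat
    by (induction n) simp_all
  then show ?thesis by (simp only:) (intro computable assms computable_on_comp[OF assms(1)])
qed

lemma computable_on_power [computable]:
  assumes "computable_on S a" "computable_on S b"
  shows "computable_on S (\<lambda>A x. a A x ^ b A x)"
proof -
  have "m ^ n = rec_nat 1 (\<lambda>_ r. r * m) n" for m n :: nat
    by (induction n) simp_all
  then show ?thesis by (simp only:) (intro computable assms computable_on_comp[OF assms(1)])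
qed

lemma computable_on_not [computable]:
  assumes "decidable_on S P"
  shows "decidable_on S (\<lambda>A x. \<not> P A x)"
proof -
  have "of_bool (\<not> P A x) = 1 - (of_bool (P A x) :: nat)" for A x
    by simp
  then show ?thesis by (simp only:) (intro computable assms)
qed

lemma computable_on_conj [computable]:
  assumes "decidable_on S P" "decidable_on S Q"
  shows "decidable_on S (\<lambda>A x. P A x \<and> Q A x)"
  unfolding of_bool_conj by (intro computable assms)

lemma computable_on_disj [computable]:
  assumes "decidable_on S P" "decidable_on S Q"
  shows "decidable_on S (\<lambda>A x. P A x \<or> Q A x)"
proof -
  have "decidable_on S (\<lambda>A x. \<not> (\<not> P A x \<and> \<not> Q A x))"
    by (intro computable assms)
  then show ?thesis by simp
qed

lemma computable_on_less [computable]: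
  assumes "computable_on S a" "computable_on S b"
  shows "decidable_on S (\<lambda>A x. a A x < b A x)"
proof -
  have "of_bool (m < n) = 1 - (1 - (n - m))" for m n :: nat
    by simp
  then show ?thesis by (simp only:) (intro computable assms)
qed

lemma computable_on_le [computable]:
  assumes "computable_on S a" "computable_on S b"
  shows "decidable_on S (\<lambda>A x. a A x \<le> b A x)"
  unfolding not_less[symmetric] by (intro computable assms)

lemma computable_on_eq [computable]:
  assumes "computable_on S a" "computable_on S b"
  shows "decidable_on S (\<lambda>A x. a A x = b A x)"
  unfolding order.eq_iff by (intro computable assms)

lemma computable_on_if [computable]:
  assumes "decidable_on S P" "computable_on S a" "computable_on S b"
  shows "computable_on S (\<lambda>A x. if P A x then a A x else b A x)"
proof -
  have "(if Q then m else n) = of_bool Q * m + (1 - of_bool Q) * n" for Q and m n :: nat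
    by simp
  then show ?thesis by (simp only:) (intro computable assms)
qed

lemma computable_on_sum [computable]:
  assumes "computable_on S (\<lambda>A z. F A (fst_code z) (snd_code z))" "computable_on S b"
  shows "computable_on S (\<lambda>A x. \<Sum>i<b A x. F A x i)"
proof -
  have "(\<Sum>i<n. f i) = rec_nat 0 (\<lambda>i r. r + f i) n" for n and f :: "nat \<Rightarrow> nat"
    by (induction n) simp_all
  then show ?thesis
    by (simp only:) (intro computable assms computable_on_comp2[OF assms(1)])
qed

lemma computable_on_all_less [computable]:
  assumes "decidable_on S (\<lambda>A z. P A (fst_code z) (snd_code z))" "computable_on S b"
  shows "decidable_on S (\<lambda>A x. \<forall>i<b A x. P A x i)"
proof -
  have "(\<forall>i<n. Q i) \<longleftrightarrow> (\<Sum>i<n. of_bool (\<not> Q i)) = (0 :: nat)" for n :: nat and Q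
    by auto
  then show ?thesis by (simp only:) (intro computable assms)
qed

lemma computable_on_ex_less [computable]:
  assumes "decidable_on S (\<lambda>A z. P A (fst_code z) (snd_code z))" "computable_on S b"
  shows "decidable_on S (\<lambda>A x. \<exists>i<b A x. P A x i)"
proof -
  have "(\<exists>i<n. Q i) \<longleftrightarrow> \<not> (\<forall>i<n. \<not> Q i)" for n :: nat and Q
    by auto
  then show ?thesis by (simp only:) (intro computable assms)
qed

lemma computable_on_card [computable]:
  assumes "decidable_on S (\<lambda>A z. P A (fst_code z) (snd_code z))" "computable_on S b"
  shows "computable_on S (\<lambda>A x. card {i. i < b A x \<and> P A x i})"
proof -
  have "card {i. i < n \<and> Q i} = (\<Sum>i<n. of_bool (Q i))" for n :: nat and Q
    by (simp add: Collect_conj_eq lessThan_def)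
  then show ?thesis by (simp only:) (intro computable assms)
qed

lemma computable_on_div [computable]:
  assumes "computable_on S a" "computable_on S b"
  shows "computable_on S (\<lambda>A x. a A x div b A x)"
proof -
  have "m div n = (if n = 0 then 0 else \<Sum>i<m. of_bool (Suc i * n \<le> m))" for m n :: nat
  proof (cases "n = 0")
    case False
    then have "Suc i * n \<le> m \<longleftrightarrow> i < m div n" for i
      by (metis Suc_le_eq less_eq_div_iff_mult_less_eq not_gr_zero)
    moreover have "m div n \<le> m" by simp
    ultimately have "{i. i < m \<and> Suc i * n \<le> m} = {..<m div n}"
      by (auto simp del: mult_Suc intro: less_le_trans)
    then have "card {i. i < m \<and> Suc i * n \<le> m} = m div n" by simp
    with False show ?thesis by (simp add: Collect_conj_eq lessThan_def)
  qed simp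
  then show ?thesis
    by (simp only:) (intro computable assms computable_on_comp[OF assms(1)] computable_on_comp[OF assms(2)])
qed

lemma computable_on_mod [computable]:
  assumes "computable_on S a" "computable_on S b"
  shows "computable_on S (\<lambda>A x. a A x mod b A x)"
  unfolding modulo_nat_def by (intro computable assms)

lemma computable_on_bit [computable]:
  assumes "computable_on S a" "computable_on S b"
  shows "decidable_on S (\<lambda>A x. bit (a A x) (b A x))"
  unfolding bit_iff_odd odd_iff_mod_2_eq_one by (intro computable assms)

lemma computable_on_Least:
  assumes "decidable_on S (\<lambda>A z. P A (fst_code z) (snd_code z))"
    and ex: "\<And>A x. A \<in> S \<Longrightarrow> \<exists>n. P A x n"
  shows "computable_on S (\<lambda>A x. LEAST n. P A x n)"
proof -
  have "decidable_on S (\<lambda>A z. \<not> P A (fst_code z) (snd_code z))"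
    by (intro computable assms)
  then obtain p where p: "\<forall>A\<in>S. \<forall>z. run A p z = Some (of_bool (\<not> P A (fst_code z) (snd_code z)))"
    unfolding computable_on_def by blast
  have "run A (MuP p) x = Some (LEAST n. P A x n)" if A: "A \<in> S" for A x
  proof -
    let ?found = "\<lambda>n. run A p (prod_encode (x, n)) = Some 0 \<and>
                      (\<forall>m<n. \<exists>k. run A p (prod_encode (x, m)) = Some (Suc k))"
    let ?l = "LEAST n. P A x n"
    have f: "?found n \<longleftrightarrow> P A x n \<and> (\<forall>m<n. \<not> P A x m)" for n
      using p A by auto
    have "?found n \<longleftrightarrow> n = ?l" for n
      unfolding f using LeastI_ex[OF ex[OF A, of x]] not_less_Least[of _ "P A x"]
      by (metis linorder_neqE_nat)
    then show ?thesis by (simp only: run.simps Let_def) (simp add: Least_equality)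
  qed
  then show ?thesis by (rule computable_onI)
qed

section \<open>Finite approximations of a computation\<close>

text \<open>
  The computation with time and use bounded by \<open>t\<close>: queries to the oracle at or beyond \<open>t\<close> and searches that
  reach \<open>t\<close> diverge. A result \<open>v\<close> is reported as \<open>Suc v\<close> and divergence as \<open>0\<close>, which makes the bounded
  computation a total number-theoretic function. At most one summand in the clause for \<open>MuP\<close> is nonzero.
\<close>

primrec run_upto :: "cantor \<Rightarrow> nat \<Rightarrow> prog \<Rightarrow> nat \<Rightarrow> nat" where
  "run_upto X t ZeroP = (\<lambda>a. 1)"
| "run_upto X t SuccP = (\<lambda>a. Suc (Suc a))"
| "run_upto X t FstP = (\<lambda>a. Suc (fst_code a))"
| "run_upto X t SndP = (\<lambda>a. Suc (snd_code a))"
| "run_upto X t OracleP = (\<lambda>a. if a < t then Suc (of_bool (X a)) else 0)"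
| "run_upto X t (PairP p q) = (\<lambda>a.
     if run_upto X t p a = 0 \<or> run_upto X t q a = 0 then 0
     else Suc (prod_encode (run_upto X t p a - 1, run_upto X t q a - 1)))"
| "run_upto X t (CompP p q) = (\<lambda>a.
     if run_upto X t q a = 0 then 0 else run_upto X t p (run_upto X t q a - 1))"
| "run_upto X t (RecP p q) = (\<lambda>b.
     rec_nat (run_upto X t p (fst_code b))
       (\<lambda>m r. if r = 0 then 0
              else run_upto X t q (prod_encode (fst_code b, prod_encode (m, r - 1)))) (snd_code b))"
| "run_upto X t (MuP p) = (\<lambda>a.
     \<Sum>n<t. if run_upto X t p (prod_encode (a, n)) = 1 \<and>
              (\<forall>m<n. 1 < run_upto X t p (prod_encode (a, m))) then Suc n else 0)"

lemma run_upto_MuP: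
  "run_upto X t (MuP p) a = Suc v \<longleftrightarrow> v < t \<and> run_upto X t p (prod_encode (a, v)) = 1 \<and>
     (\<forall>m<v. 1 < run_upto X t p (prod_encode (a, m)))" (is "?l \<longleftrightarrow> _")
proof -
  let ?found = "\<lambda>n. run_upto X t p (prod_encode (a, n)) = 1 \<and>
              (\<forall>m<n. 1 < run_upto X t p (prod_encode (a, m)))"
  have uniq: "n = n'" if "?found n" "?found n'" for n n'
    using that by (metis less_irrefl linorder_neqE_nat)
  have val: "run_upto X t (MuP p) a = Suc n" if "n < t" "?found n" for n
  proof -
    have "?found i \<longleftrightarrow> i = n" for i
      using that(2) uniq by blast
    then have "run_upto X t (MuP p) a = (\<Sum>i<t. if i = n then Suc i else 0)"
      by (simp only: run_upto.simps)
    with that(1) show ?thesis by simp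
  qed
  have "\<exists>n<t. ?found n" if "run_upto X t (MuP p) a \<noteq> 0"
  proof (rule ccontr)
    assume "\<not> (\<exists>n<t. ?found n)"
    then have "(if ?found i then Suc i else 0) = 0" if "i \<in> {..<t}" for i
      using that by (simp only: lessThan_iff) meson
    then have "run_upto X t (MuP p) a = 0"
      unfolding run_upto.simps by (intro sum.neutral ballI)
    with that show False by simp
  qed
  with val show ?thesis by (metis nat.distinct(1) nat.inject)
qed

lemma run_MuP:
  "run A (MuP p) a = Some v \<longleftrightarrow> run A p (prod_encode (a, v)) = Some 0 \<and>
     (\<forall>m<v. \<exists>k. run A p (prod_encode (a, m)) = Some (Suc k))"
proof -
  let ?found = "\<lambda>n. run A p (prod_encode (a, n)) = Some 0 \<and>
              (\<forall>m<n. \<exists>k. run A p (prod_encode (a, m)) = Some (Suc k))"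
  have uniq: "n = n'" if "?found n" "?found n'" for n n'
    using that by (metis linorder_neqE_nat nat.distinct(1) option.inject)
  have "(LEAST n. ?found n) = v" if "?found v" for v
    using that uniq by (intro Least_equality) (simp, metis order_refl)
  then show ?thesis
    unfolding run.simps Let_def by (smt (verit, best) option.distinct(1) option.inject uniq)
qed

lemma run_upto_mono:
  "run_upto X t p a = Suc v \<Longrightarrow> t \<le> t' \<Longrightarrow> run_upto X t' p a = Suc v"
proof (induction p arbitrary: a v)
  case OracleP
  then show ?case by (auto split: if_splits)
next
  case (PairP p q)
  from PairP.prems(1) have nz: "run_upto X t p a \<noteq> 0" "run_upto X t q a \<noteq> 0"
    and v: "v = prod_encode (run_upto X t p a - 1, run_upto X t q a - 1)"
    by (simp_all split: if_splits)
  from nz obtain y z where yz: "run_upto X t p a = Suc y" "run_upto X t q a = Suc z"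
    using not0_implies_Suc by blast
  show ?case using v PairP.IH(1)[OF yz(1) PairP.prems(2)] PairP.IH(2)[OF yz(2) PairP.prems(2)] by (simp add: yz)
next
  case (CompP p q)
  from CompP.prems(1) obtain z where z: "run_upto X t q a = Suc z"
    using not0_implies_Suc by (fastforce split: if_splits)
  with CompP.prems(1) have v: "run_upto X t p z = Suc v" by simp
  show ?case using CompP.IH(1)[OF v CompP.prems(2)] CompP.IH(2)[OF z CompP.prems(2)] by simp
next
  case (RecP p q)
  have "rec_nat (run_upto X t p x)
       (\<lambda>m r. if r = 0 then 0 else run_upto X t q (prod_encode (x, prod_encode (m, r - 1)))) n = Suc v \<Longrightarrow>
     rec_nat (run_upto X t' p x)
       (\<lambda>m r. if r = 0 then 0 else run_upto X t' q (prod_encode (x, prod_encode (m, r - 1)))) n = Suc v"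
    for x n v
  proof (induction n arbitrary: v)
    case 0
    then show ?case using RecP.IH(1) RecP.prems by simp
  next
    case (Suc n)
    from Suc.prems obtain y where y: "rec_nat (run_upto X t p x)
       (\<lambda>m r. if r = 0 then 0 else run_upto X t q (prod_encode (x, prod_encode (m, r - 1)))) n = Suc y"
      using not0_implies_Suc by (fastforce split: if_splits)
    from Suc.prems Suc.IH[OF y] show ?case
      using RecP.IH(2) RecP.prems(2) by (simp add: y)
  qed
  with RecP.prems show ?case by simp
next
  case (MuP p)
  have "1 < run_upto X t' p b" if "1 < run_upto X t p b" for b
  proof -
    from that obtain k where "run_upto X t p b = Suc (Suc k)" by (metis less_imp_Suc_add plus_1_eq_Suc)
    with MuP.IH MuP.prems(2) show ?thesis by simp
  qed
  moreover from MuP.prems(1) have "v < t" and p: "run_upto X t p (prod_encode (a, v)) = Suc 0"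
    and "\<forall>m<v. 1 < run_upto X t p (prod_encode (a, m))"
    unfolding run_upto_MuP by simp_all
  moreover note MuP.IH[OF p MuP.prems(2)]
  ultimately show ?case unfolding run_upto_MuP using MuP.prems(2) by simp
qed simp_all

lemma run_upto_sound: "run_upto X t p a = Suc v \<Longrightarrow> run X p a = Some v"
proof (induction p arbitrary: a v)
  case OracleP
  then show ?case by (auto split: if_splits)
next
  case (PairP p q)
  from PairP.prems(1) have nz: "run_upto X t p a \<noteq> 0" "run_upto X t q a \<noteq> 0"
    and v: "v = prod_encode (run_upto X t p a - 1, run_upto X t q a - 1)"
    by (simp_all split: if_splits)
  from nz obtain y z where yz: "run_upto X t p a = Suc y" "run_upto X t q a = Suc z"
    using not0_implies_Suc by blast
  show ?case using v PairP.IH(1)[OF yz(1)] PairP.IH(2)[OF yz(2)] by (simp add: yz)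
next
  case (CompP p q)
  from CompP.prems(1) obtain z where z: "run_upto X t q a = Suc z"
    using not0_implies_Suc by (fastforce split: if_splits)
  with CompP.prems(1) have v: "run_upto X t p z = Suc v" by simp
  show ?case using CompP.IH(1)[OF v] CompP.IH(2)[OF z] by simp
next
  case (RecP p q)
  have "rec_nat (run_upto X t p x)
       (\<lambda>m r. if r = 0 then 0 else run_upto X t q (prod_encode (x, prod_encode (m, r - 1)))) n = Suc v \<Longrightarrow>
     rec_nat (run X p x)
       (\<lambda>m r. Option.bind r (\<lambda>y. run X q (prod_encode (x, prod_encode (m, y))))) n = Some v"
    for x n v
  proof (induction n arbitrary: v)
    case 0
    then show ?case using RecP.IH(1) by simp
  next
    case (Suc n)
    from Suc.prems obtain y where y: "rec_nat (run_upto X t p x)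
       (\<lambda>m r. if r = 0 then 0 else run_upto X t q (prod_encode (x, prod_encode (m, r - 1)))) n = Suc y"
      using not0_implies_Suc by (fastforce split: if_splits)
    from Suc.prems Suc.IH[OF y] show ?case
      using RecP.IH(2) by (simp add: y)
  qed
  with RecP.prems show ?case by (simp add: case_prod_beta)
next
  case (MuP p)
  have "\<exists>k. run X p b = Some (Suc k)" if "1 < run_upto X t p b" for b
  proof -
    from that obtain k where "run_upto X t p b = Suc (Suc k)" by (metis less_imp_Suc_add plus_1_eq_Suc)
    with MuP.IH show ?thesis by blast
  qed
  moreover from MuP.prems(1) have p: "run_upto X t p (prod_encode (a, v)) = Suc 0"
    and "\<forall>m<v. 1 < run_upto X t p (prod_encode (a, m))"
    unfolding run_upto_MuP by simp_all
  moreover note MuP.IH[OF p]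
  ultimately show ?case unfolding run_MuP by blast
qed simp_all

lemma run_upto_complete: "run X p a = Some v \<Longrightarrow> \<exists>t. run_upto X t p a = Suc v"
proof (induction p arbitrary: a v)
  case OracleP
  then show ?case by (intro exI[of _ "Suc a"]) simp
next
  case (PairP p q)
  then obtain y z where yz: "run X p a = Some y" "run X q a = Some z" "v = prod_encode (y, z)"
    by (auto simp: bind_eq_Some_conv)
  with PairP.IH obtain t1 t2 where t: "run_upto X t1 p a = Suc y" "run_upto X t2 q a = Suc z"
    by blast
  then have "run_upto X (max t1 t2) p a = Suc y" "run_upto X (max t1 t2) q a = Suc z"
    using t[THEN run_upto_mono, of "max t1 t2"] by simp_all
  with yz show ?case by (intro exI[of _ "max t1 t2"]) simp
next
  case (CompP p q)
  then obtain y where y: "run X q a = Some y" "run X p y = Some v"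
    by (auto simp: bind_eq_Some_conv)
  with CompP.IH obtain t1 t2 where t: "run_upto X t1 q a = Suc y" "run_upto X t2 p y = Suc v"
    by blast
  then have "run_upto X (max t1 t2) q a = Suc y" "run_upto X (max t1 t2) p y = Suc v"
    using t[THEN run_upto_mono, of "max t1 t2"] by simp_all
  then show ?case by (intro exI[of _ "max t1 t2"]) simp
next
  case (RecP p q)
  define x where "x = fst_code a"
  have "\<exists>t. run_upto X t (RecP p q) (prod_encode (x, n)) = Suc v"
    if "rec_nat (run X p x)
       (\<lambda>m r. Option.bind r (\<lambda>y. run X q (prod_encode (x, prod_encode (m, y))))) n = Some v"
    for n v
    using that
  proof (induction n arbitrary: v)
    case 0
    then show ?case using RecP.IH(1) by simp
  next
    case (Suc n)
    from Suc.prems obtain y where y: "rec_nat (run X p x)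
       (\<lambda>m r. Option.bind r (\<lambda>y. run X q (prod_encode (x, prod_encode (m, y))))) n = Some y"
      and q: "run X q (prod_encode (x, prod_encode (n, y))) = Some v"
      by (auto simp: bind_eq_Some_conv)
    from Suc.IH[OF y] RecP.IH(2)[OF q] obtain t1 t2
      where t: "run_upto X t1 (RecP p q) (prod_encode (x, n)) = Suc y"
        "run_upto X t2 q (prod_encode (x, prod_encode (n, y))) = Suc v" by blast
    have "run_upto X (max t1 t2) (RecP p q) (prod_encode (x, n)) = Suc y"
        "run_upto X (max t1 t2) q (prod_encode (x, prod_encode (n, y))) = Suc v"
      by (rule run_upto_mono[OF t(1)], simp) (rule run_upto_mono[OF t(2)], simp)
    moreover have "run_upto X t (RecP p q) (prod_encode (x, Suc n)) =
       (if run_upto X t (RecP p q) (prod_encode (x, n)) = 0 then 0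
        else run_upto X t q (prod_encode (x, prod_encode (n, run_upto X t (RecP p q) (prod_encode (x, n)) - 1))))"
      for t by (simp cong: if_cong)
    ultimately show ?case by (intro exI[of _ "max t1 t2"]) (simp del: run_upto.simps(8))
  qed
  from this[of "snd_code a" v] RecP.prems show ?case
    by (simp add: case_prod_beta x_def)
next
  case (MuP p)
  then have f: "run X p (prod_encode (a, v)) = Some 0"
    "\<forall>m<v. \<exists>k. run X p (prod_encode (a, m)) = Some (Suc k)"
    unfolding run_MuP by auto
  from MuP.IH[OF f(1)] obtain t0 where t0: "run_upto X t0 p (prod_encode (a, v)) = Suc 0" by blast
  have "\<forall>m<v. \<exists>t. 1 < run_upto X t p (prod_encode (a, m))"
  proof (intro allI impI)
    fix m assume "m < v"
    with f(2) obtain k where "run X p (prod_encode (a, m)) = Some (Suc k)" by blast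
    from MuP.IH[OF this] obtain t where "run_upto X t p (prod_encode (a, m)) = Suc (Suc k)"
      by blast
    then have "1 < run_upto X t p (prod_encode (a, m))" by simp
    then show "\<exists>t. 1 < run_upto X t p (prod_encode (a, m))" ..
  qed
  then obtain u where u: "\<And>m. m < v \<Longrightarrow> 1 < run_upto X (u m) p (prod_encode (a, m))" by metis
  define t where "t = t0 + (\<Sum>m<v. u m) + Suc v"
  have "run_upto X t p (prod_encode (a, v)) = Suc 0"
    by (rule run_upto_mono[OF t0]) (simp add: t_def)
  moreover have "1 < run_upto X t p (prod_encode (a, m))" if "m < v" for m
  proof -
    from u[OF that] obtain k where k: "run_upto X (u m) p (prod_encode (a, m)) = Suc (Suc k)"
      by (metis less_imp_Suc_add plus_1_eq_Suc)
    have "u m \<le> (\<Sum>m<v. u m)" using that by (intro member_le_sum) auto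
    then have "u m \<le> t" by (simp add: t_def)
    from run_upto_mono[OF k this] show ?thesis by simp
  qed
  moreover have "v < t" by (simp add: t_def)
  ultimately show ?case unfolding run_upto_MuP by auto
qed simp_all

lemma run_upto_use: "(\<And>i. i < t \<Longrightarrow> X i = Y i) \<Longrightarrow> run_upto X t p = run_upto Y t p"
  by (induction p) (simp_all add: fun_eq_iff cong: if_cong)

text \<open>
  For each program separately, a program that computes its approximations is found by recursion on the structure. The oracle \<open>X\<close> of the simulated program is itself computed.
\<close>

lemma computable_on_run_upto [computable]:
  assumes "decidable_on S (\<lambda>A z. X A (fst_code z) (snd_code z))"
    and "computable_on S t" and "computable_on S a"
  shows "computable_on S (\<lambda>A x. run_upto (X A x) (t A x) p (a A x))"
proof -
  have X: "decidable_on S (\<lambda>A x. X A (f A x) (g A x))"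
    if "computable_on S f" "computable_on S g" for f g
    using computable_on_comp2[OF assms(1) that] .
  have t: "computable_on S (\<lambda>A x. t A (f A x))" if "computable_on S f" for f
    using computable_on_comp[OF assms(2) that] .
  have "computable_on S (\<lambda>A z. run_upto (X A (fst_code z)) (t A (fst_code z)) p (snd_code z))"
  proof (induction p)
    case (PairP p q)
    have 1: "computable_on S (\<lambda>A x. run_upto (X A (f A x)) (t A (f A x)) p (g A x))"
      if "computable_on S f" "computable_on S g" for f g
      using computable_on_comp2[OF PairP(1) that] .
    have 2: "computable_on S (\<lambda>A x. run_upto (X A (f A x)) (t A (f A x)) q (g A x))"
      if "computable_on S f" "computable_on S g" for f g
      using computable_on_comp2[OF PairP(2) that] .
    show ?case
      unfolding run_upto.simps by (intro computable 1 2)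
  next
    case (CompP p q)
    have 1: "computable_on S (\<lambda>A x. run_upto (X A (f A x)) (t A (f A x)) p (g A x))"
      if "computable_on S f" "computable_on S g" for f g
      using computable_on_comp2[OF CompP(1) that] .
    show ?case
      unfolding run_upto.simps by (intro computable 1 CompP)
  next
    case (RecP p q)
    have 1: "computable_on S (\<lambda>A x. run_upto (X A (f A x)) (t A (f A x)) p (g A x))"
      if "computable_on S f" "computable_on S g" for f g
      using computable_on_comp2[OF RecP(1) that] .
    have 2: "computable_on S (\<lambda>A x. run_upto (X A (f A x)) (t A (f A x)) q (g A x))"
      if "computable_on S f" "computable_on S g" for f g
      using computable_on_comp2[OF RecP(2) that] .
    show ?case
      unfolding run_upto.simps by (intro computable 1 2)
  next
    case (MuP p)
    have 1: "computable_on S (\<lambda>A x. run_upto (X A (f A x)) (t A (f A x)) p (g A x))"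
      if "computable_on S f" "computable_on S g" for f g
      using computable_on_comp2[OF MuP(1) that] .
    show ?case
      unfolding run_upto.simps by (intro computable 1 t)
  qed (unfold run_upto.simps, (intro computable X t)+)
  from computable_on_comp2[OF this computable_on_id assms(3)] show ?thesis .
qed

section \<open>Relative computability and the jump\<close>

lemma computable_on_index_const_prog [computable]:
  "computable_on S a \<Longrightarrow> computable_on S (\<lambda>A x. index (const_prog (a A x)))"
proof -
  have "index (const_prog n) = rec_nat 0 (\<lambda>m r. 6 + 4 * prod_encode (1, r)) n" for n
    by (induction n) simp_all
  then show "computable_on S a \<Longrightarrow> ?thesis" by (simp only:) (intro computable)
qed

lemma jump_index: "jump A (index p) \<longleftrightarrow> halts A p (index p)"
  using bij_index unfolding jump_def bij_def inj_def by metis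

text \<open>
  Unbounded search for a witness, as a halting problem. This is how existential statements become
  computably enumerable sets and questions to the jump.
\<close>

lemma semidecidable:
  assumes "decidable_on {A} (\<lambda>_ z. R (fst_code z) (snd_code z))"
  obtains p where "\<And>x. halts A p x \<longleftrightarrow> (\<exists>t. R x t)"
proof -
  have "decidable_on {A} (\<lambda>_ z. \<not> R (fst_code z) (snd_code z))"
    by (intro computable assms)
  then obtain p where p: "\<And>z. run A p z = Some (of_bool (\<not> R (fst_code z) (snd_code z)))"
    unfolding computable_on_def by blast
  have "halts A (MuP p) x \<longleftrightarrow> (\<exists>t. R x t)" for x
  proof -
    have "run A (MuP p) x = Some v \<longleftrightarrow> R x v \<and> (\<forall>m<v. \<not> R x m)" for v
      unfolding run_MuP using p by auto
    then show ?thesis unfolding halts_def by (metis exists_least_iff not_None_eq)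
  qed
  then show ?thesis by (rule that)
qed

text \<open>
  The jump evaluates a program at its own index only. A program preceded by a constant ignores its argument, and
  the index of that composition is a computable function of the constant.
\<close>

lemma decidable_in_jump_ex:
  assumes "decidable_on {A} (\<lambda>_ z. R (fst_code z) (snd_code z))"
  shows "decidable_on {jump A} (\<lambda>_ x. \<exists>t. R x t)"
proof -
  obtain p where p: "\<And>x. halts A p x \<longleftrightarrow> (\<exists>t. R x t)"
    using semidecidable[OF assms] by blast
  have "jump A (6 + 4 * prod_encode (index p, index (const_prog x))) \<longleftrightarrow> (\<exists>t. R x t)" for x
    using jump_index[of A "CompP p (const_prog x)"] p[of x] by (simp add: halts_def)
  moreover have "decidable_on {jump A} (\<lambda>B x. B (6 + 4 * prod_encode (index p, index (const_prog x))))"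
    by (intro computable)
  ultimately show ?thesis by (auto elim: computable_on_cong)
qed

lemma decidable_in_jump_all:
  assumes "decidable_on {A} (\<lambda>_ z. R (fst_code z) (snd_code z))"
  shows "decidable_on {jump A} (\<lambda>_ x. \<forall>t. R x t)"
proof -
  have "decidable_on {jump A} (\<lambda>_ x. \<not> (\<exists>t. \<not> R x t))"
    by (intro computable decidable_in_jump_ex assms)
  then show ?thesis by simp
qed

lemma computable_in_jump:
  assumes "computable_on {A} (\<lambda>_. F)"
  shows "computable_on {jump A} (\<lambda>_. F)"
proof -
  \<comment> \<open>The vacuous quantifier casts the graph as a question to the jump.\<close>
  have "decidable_on {jump A} (\<lambda>_ z. \<exists>t::nat. F (fst_code z) = snd_code z)"
    by (rule decidable_in_jump_ex) (intro computable computable_on_comp[OF assms])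
  then have "decidable_on {jump A} (\<lambda>_ z. F (fst_code z) = snd_code z)"
    by simp
  then have "computable_on {jump A} (\<lambda>_ x. LEAST n. F x = n)"
    by (rule computable_on_Least) blast
  then show ?thesis by (simp add: Least_equality)
qed

text \<open>
  Replacing each query \<open>n\<close> of a program by the query \<open>2 * n + 1\<close> makes it read \<open>Z\<close> inside \<open>join y Z\<close>.
\<close>

lemma computable_on_join:
  assumes "computable_on {Z} (\<lambda>_. F)"
  shows "computable_on (range (\<lambda>y. join y Z)) (\<lambda>_. F)"
proof -
  have "\<exists>q. \<forall>y. run (join y Z) q = run Z p" for p
  proof (induction p)
    case OracleP
    have "computable_on UNIV (\<lambda>A n. Suc (2 * n))" by (intro computable)
    then obtain d where d: "\<And>A n. run A d n = Some (Suc (2 * n))"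
      unfolding computable_on_def by blast
    have "run (join y Z) (CompP OracleP d) = run Z OracleP" for y
      by (simp add: d join_def fun_eq_iff)
    then show ?case by blast
  next
    case (PairP p q)
    then obtain p' q' where "\<forall>y. run (join y Z) p' = run Z p" "\<forall>y. run (join y Z) q' = run Z q" by blast
    then have "\<forall>y. run (join y Z) (PairP p' q') = run Z (PairP p q)" by simp
    then show ?case by blast
  next
    case (CompP p q)
    then obtain p' q' where "\<forall>y. run (join y Z) p' = run Z p" "\<forall>y. run (join y Z) q' = run Z q" by blast
    then have "\<forall>y. run (join y Z) (CompP p' q') = run Z (CompP p q)" by simp
    then show ?case by blast
  next
    case (RecP p q)
    then obtain p' q' where "\<forall>y. run (join y Z) p' = run Z p" "\<forall>y. run (join y Z) q' = run Z q" by blast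
    then have "\<forall>y. run (join y Z) (RecP p' q') = run Z (RecP p q)" by simp
    then show ?case by blast
  next
    case (MuP p)
    then obtain p' where "\<forall>y. run (join y Z) p' = run Z p" by blast
    then have "\<forall>y. run (join y Z) (MuP p') = run Z (MuP p)" by simp
    then show ?case by blast
  qed (metis run.simps(1) run.simps(2) run.simps(3) run.simps(4))+
  then show ?thesis
    using assms unfolding computable_on_def by (metis (no_types, lifting) rangeE singletonI)
qed

section \<open>Prefixes coded by numbers, and the uniform measure\<close>

text \<open>
  A string of length \<open>n\<close> is represented by the number below \<open>2 ^ n\<close> with these binary digits, so that
  quantification over strings and counting of strings are bounded arithmetic. Conversely \<open>bit s\<close> is the real
  that continues the string \<open>s\<close> with zeros.
\<close>

definition prefix_code :: "cantor \<Rightarrow> nat \<Rightarrow> nat" where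
  "prefix_code X n = (\<Sum>i<n. of_bool (X i) * 2 ^ i)"

lemma prefix_code_horner: "prefix_code X n = horner_sum of_bool 2 (map X [0..<n])"
  by (simp add: prefix_code_def horner_sum_eq_sum atLeast0LessThan)

lemma bit_prefix_code: "bit (prefix_code X n) i \<longleftrightarrow> i < n \<and> X i"
  by (simp add: prefix_code_horner bit_horner_sum_bit_iff) auto

lemma prefix_code_bit: "prefix_code (bit s) n = s mod 2 ^ n"
  unfolding take_bit_eq_mod[symmetric]
  by (rule bit_eqI) (auto simp: bit_prefix_code bit_take_bit_iff)

lemma prefix_code_cong: "(\<And>i. i < n \<Longrightarrow> X i = Y i) \<Longrightarrow> prefix_code X n = prefix_code Y n"
  by (simp add: prefix_code_def)

lemma prefix_code_bit_prefix_code: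
  "m \<le> n \<Longrightarrow> prefix_code (bit (prefix_code X n)) m = prefix_code X m"
  by (rule prefix_code_cong) (simp add: bit_prefix_code)

lemma prefix_code_mod: "m \<le> n \<Longrightarrow> prefix_code X n mod 2 ^ m = prefix_code X m"
  by (metis prefix_code_bit prefix_code_bit_prefix_code)

lemma prefix_code_less: "prefix_code X n < 2 ^ n"
  by (metis mod_less_divisor order_refl prefix_code_mod zero_less_numeral zero_less_power)

lemma prefix_code_eq_iff: "s < 2 ^ n \<Longrightarrow> prefix_code X n = s \<longleftrightarrow> (\<forall>i<n. X i = bit s i)"
  by (metis bit_prefix_code mod_less prefix_code_bit prefix_code_cong)

lemma computable_on_prefix_code [computable]:
  assumes "decidable_on S (\<lambda>A z. X A (fst_code z) (snd_code z))" "computable_on S n"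
  shows "computable_on S (\<lambda>A x. prefix_code (X A x) (n A x))"
  unfolding prefix_code_def by (intro computable assms)

interpretation coin: prob_space coin_measure
proof -
  interpret product_prob_space "\<lambda>_::nat. uniform_count_measure (UNIV :: bool set)" UNIV
    by (intro product_prob_spaceI prob_space_uniform_count_measure) auto
  show "prob_space coin_measure" unfolding coin_measure_def by (rule P.prob_space_axioms)
qed

lemma space_coin_measure [simp]: "space coin_measure = UNIV"
  by (simp add: coin_measure_def space_PiM space_uniform_count_measure)

lemma measure_prefix_code_eq:
  assumes "s < 2 ^ n"
  shows "{x. prefix_code x n = s} \<in> sets coin_measure"
    and "measure coin_measure {x. prefix_code x n = s} = 1 / 2 ^ n"
proof -
  let ?U = "uniform_count_measure (UNIV :: bool set)"
  interpret product_prob_space "\<lambda>_::nat. ?U" UNIV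
    by (intro product_prob_spaceI prob_space_uniform_count_measure) auto
  let ?S = "{x \<in> space coin_measure. \<forall>i\<in>{..<n}. x i \<in> {bit s i}}"
  have eq: "{x. prefix_code x n = s} = ?S"
    using prefix_code_eq_iff[OF assms] by auto
  have "emeasure coin_measure ?S = (\<Prod>i\<in>{..<n}. emeasure ?U {bit s i})"
    unfolding coin_measure_def
    by (rule emeasure_PiM_Collect) (auto simp: sets_uniform_count_measure)
  also have "\<dots> = (\<Prod>i\<in>{..<n}. ennreal (1 / 2))"
    by (intro prod.cong refl) (subst emeasure_uniform_count_measure, auto)
  also have "\<dots> = ennreal ((1 / 2) ^ n)"
    unfolding prod_constant by (simp only: ennreal_power card_lessThan)
  finally show "measure coin_measure {x. prefix_code x n = s} = 1 / 2 ^ n"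
    unfolding eq by (simp add: measure_def power_one_over)
  have "?S \<in> sets coin_measure"
    unfolding coin_measure_def
    by (intro sets.sets_Collect_finite_All sets_Collect_single) (auto simp: sets_uniform_count_measure)
  then show "{x. prefix_code x n = s} \<in> sets coin_measure" by (simp only: eq)
qed

lemma sets_prefix_code : "{x. P (prefix_code x n)} \<in> sets coin_measure"
proof -
  have "{x. P (prefix_code x n)} = (\<Union>s\<in>{s. s < 2 ^ n \<and> P s}. {x. prefix_code x n = s})"
    using prefix_code_less by auto
  also have "\<dots> \<in> sets coin_measure"
    by (rule sets.finite_UN) (auto intro: measure_prefix_code_eq(1))
  finally show ?thesis .
qed

lemma measure_prefix_code:
  "measure coin_measure {x. P (prefix_code x n)} = card {s. s < 2 ^ n \<and> P s} / 2 ^ n"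
proof -
  have "{x. P (prefix_code x n)} = (\<Union>s\<in>{s. s < 2 ^ n \<and> P s}. {x. prefix_code x n = s})"
    using prefix_code_less by auto
  then have "measure coin_measure {x. P (prefix_code x n)} =
      (\<Sum>s\<in>{s. s < 2 ^ n \<and> P s}. measure coin_measure {x. prefix_code x n = s})"
    by (simp only:) (rule coin.finite_measure_finite_Union,
        auto simp: disjoint_family_on_def intro: measure_prefix_code_eq(1))
  then show ?thesis by (simp add: measure_prefix_code_eq(2))
qed

text \<open>
  Clopen sets, with a bound on the number of bits that decide membership. Their measure is a
  finite count, hence computable.
\<close>

definition determined_by :: "nat \<Rightarrow> (cantor \<Rightarrow> bool) \<Rightarrow> bool" where
  "determined_by n Q \<longleftrightarrow> (\<forall>X. Q (bit (prefix_code X n)) = Q X)"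

lemma determined_byI:
  assumes "\<And>X Y. (\<And>i. i < n \<Longrightarrow> X i = Y i) \<Longrightarrow> Q X \<Longrightarrow> Q Y"
  shows "determined_by n Q"
  unfolding determined_by_def using assms bit_prefix_code by metis

lemma sets_determined_by:
  assumes "determined_by n Q"
  shows "{x. Q x} \<in> sets coin_measure"
proof -
  have "{x. Q x} = {x. Q (bit (prefix_code x n))}"
    using assms by (simp add: determined_by_def)
  also have "\<dots> \<in> sets coin_measure" by (rule sets_prefix_code)
  finally show ?thesis .
qed

lemma measure_determined_by:
  assumes "determined_by n Q"
  shows "measure coin_measure {x. Q x} = card {s::nat. s < 2 ^ n \<and> Q (bit s)} / 2 ^ n"
proof -
  have "{x. Q x} = {x. Q (bit (prefix_code x n))}"
    using assms by (simp add: determined_by_def)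
  with measure_prefix_code[of "\<lambda>s. Q (bit s)" n] show ?thesis by (simp only:)
qed

lemma measure_increasing_union:
  fixes Q :: "nat \<Rightarrow> cantor \<Rightarrow> bool"
  assumes "\<And>t. determined_by t (Q t)" "\<And>s t x. s \<le> t \<Longrightarrow> Q s x \<Longrightarrow> Q t x"
  shows "{x. \<exists>t. Q t x} \<in> sets coin_measure"
    and "(\<lambda>t. measure coin_measure {x. Q t x}) \<longlonglongrightarrow> measure coin_measure {x. \<exists>t. Q t x}"
proof -
  have eq: "{x. \<exists>t. Q t x} = (\<Union>t. {x. Q t x})" by auto
  show "{x. \<exists>t. Q t x} \<in> sets coin_measure"
    unfolding eq using sets_determined_by[OF assms(1)] by auto
  show "(\<lambda>t. measure coin_measure {x. Q t x}) \<longlonglongrightarrow> measure coin_measure {x. \<exists>t. Q t x}"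
    unfolding eq using sets_determined_by[OF assms(1)] assms(2)
    by (intro coin.finite_Lim_measure_incseq) (auto simp: incseq_def)
qed

lemma measure_decreasing_inter:
  fixes Q :: "nat \<Rightarrow> cantor \<Rightarrow> bool"
  assumes "\<And>t. determined_by t (Q t)" "\<And>s t x. s \<le> t \<Longrightarrow> Q t x \<Longrightarrow> Q s x"
  shows "{x. \<forall>t. Q t x} \<in> sets coin_measure"
    and "(\<lambda>t. measure coin_measure {x. Q t x}) \<longlonglongrightarrow> measure coin_measure {x. \<forall>t. Q t x}"
proof -
  have eq: "{x. \<forall>t. Q t x} = (\<Inter>t. {x. Q t x})" by auto
  show "{x. \<forall>t. Q t x} \<in> sets coin_measure"
    unfolding eq using sets_determined_by[OF assms(1)] by auto
  show "(\<lambda>t. measure coin_measure {x. Q t x}) \<longlonglongrightarrow> measure coin_measure {x. \<forall>t. Q t x}"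
    unfolding eq using sets_determined_by[OF assms(1)] assms(2)
    by (intro coin.finite_Lim_measure_decseq) (auto simp: decseq_def)
qed

lemma measure_union_le:
  assumes "\<And>n. B n \<in> sets coin_measure" and "\<And>n. measure coin_measure (B n) \<le> \<epsilon> / 2 ^ n"
  shows "measure coin_measure (\<Union>n. B n) \<le> 2 * \<epsilon>"
proof -
  have sums: "(\<lambda>n. \<epsilon> / 2 ^ n) sums (2 * \<epsilon>)"
    using sums_mult[OF geometric_sums[of "1/2 :: real"], of \<epsilon>]
    by (simp add: power_one_over mult.commute)
  then have summable: "summable (\<lambda>n. measure coin_measure (B n))"
    by (intro summable_comparison_test'[OF sums_summable[OF sums]]) (simp add: assms(2))
  then have "measure coin_measure (\<Union>n. B n) \<le> (\<Sum>n. measure coin_measure (B n))"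
    using assms(1) by (intro coin.finite_measure_subadditive_countably) auto
  also have "\<dots> \<le> (\<Sum>n. \<epsilon> / 2 ^ n)"
    by (intro suminf_le assms(2) summable sums_summable[OF sums])
  also have "\<dots> = 2 * \<epsilon>" using sums by (rule sums_unique[symmetric])
  finally show ?thesis .
qed

section \<open>Waiting until an open set is nearly exhausted\<close>

text \<open>
  For an increasing sequence of clopen sets \<open>Q t\<close>, with \<open>Q t\<close> determined by \<open>t\<close> bits, this says that no later
  stage adds more than measure \<open>1 / 2 ^ w\<close> to stage \<open>s\<close>. It is stated by counting strings, so that it is a
  universal statement about a decidable relation and can be decided by the jump.
\<close>

definition settled :: "(nat \<Rightarrow> cantor \<Rightarrow> bool) \<Rightarrow> nat \<Rightarrow> nat \<Rightarrow> bool" where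
  "settled Q w s \<longleftrightarrow> (\<forall>t. card {v::nat. v < 2 ^ t \<and> Q t (bit v) \<and> \<not> Q s (bit v)} * 2 ^ w \<le> 2 ^ t)"

definition settling_time :: "(nat \<Rightarrow> cantor \<Rightarrow> bool) \<Rightarrow> nat \<Rightarrow> nat" where
  "settling_time Q w = (LEAST s. settled Q w s)"

context
  fixes Q :: "nat \<Rightarrow> cantor \<Rightarrow> bool"
  assumes det: "\<And>t. determined_by t (Q t)"
    and incr: "\<And>s t x. s \<le> t \<Longrightarrow> Q s x \<Longrightarrow> Q t x"
begin

lemma measure_ever:
  shows "{x. \<exists>t. Q t x} \<in> sets coin_measure"
    and "(\<lambda>t. measure coin_measure {x. Q t x}) \<longlonglongrightarrow> measure coin_measure {x. \<exists>t. Q t x}"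
  by (rule measure_increasing_union[OF det], erule (1) incr)+

lemma card_unsettled:
  assumes "s \<le> t"
  shows "card {v::nat. v < 2 ^ t \<and> Q t (bit v) \<and> \<not> Q s (bit v)} =
    2 ^ t * measure coin_measure {x. Q t x \<and> \<not> Q s x}"
proof -
  have "determined_by t (\<lambda>x. Q t x \<and> \<not> Q s x)"
  proof (rule determined_byI)
    fix X Y :: cantor
    assume eq: "\<And>i. i < t \<Longrightarrow> X i = Y i" and X: "Q t X \<and> \<not> Q s X"
    have "prefix_code X t = prefix_code Y t" "prefix_code X s = prefix_code Y s"
      using eq assms by (auto intro: prefix_code_cong)
    with X det[of t] det[of s] show "Q t Y \<and> \<not> Q s Y"
      unfolding determined_by_def by metis
  qed
  from measure_determined_by[OF this] show ?thesis by simp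
qed

lemma ex_settled: "\<exists>s. settled Q w s"
proof -
  note lim = measure_ever
  let ?m = "\<lambda>t. measure coin_measure {x. Q t x}"
  let ?L = "measure coin_measure {x. \<exists>t. Q t x}"
  have "?L - 1 / 2 ^ w < ?L" by simp
  then have "\<forall>\<^sub>F s in sequentially. ?L - 1 / 2 ^ w < ?m s"
    by (rule order_tendstoD(1)[OF lim(2)])
  then obtain s where s: "?L - 1 / 2 ^ w < ?m s"
    using eventually_happens'[OF sequentially_bot] by blast
  have "card {v::nat. v < 2 ^ t \<and> Q t (bit v) \<and> \<not> Q s (bit v)} * 2 ^ w \<le> 2 ^ t" for t
  proof (cases "s \<le> t")
    case True
    have "{x. Q t x \<and> \<not> Q s x} = {x. Q t x} - {x. Q s x}" by auto
    moreover have "{x. Q s x} \<subseteq> {x. Q t x}"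
      using incr[OF True] by blast
    ultimately have "measure coin_measure {x. Q t x \<and> \<not> Q s x} = ?m t - ?m s"
      using sets_determined_by[OF det] by (simp only: coin.finite_measure_Diff)
    also have "?m t \<le> ?L"
      by (rule coin.finite_measure_mono) (auto simp: lim(1))
    finally have "measure coin_measure {x. Q t x \<and> \<not> Q s x} \<le> 1 / 2 ^ w" using s by linarith
    then have "2 ^ t * measure coin_measure {x. Q t x \<and> \<not> Q s x} * 2 ^ w \<le> 2 ^ t"
      by (simp add: field_simps)
    then have "real (card {v::nat. v < 2 ^ t \<and> Q t (bit v) \<and> \<not> Q s (bit v)} * 2 ^ w) \<le> real (2 ^ t)"
      by (simp add: card_unsettled[OF True])
    then show ?thesis by (simp only: of_nat_le_iff)
  next
    case False
    then have "{v::nat. v < 2 ^ t \<and> Q t (bit v) \<and> \<not> Q s (bit v)} = {}"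
      using incr[of t s] by auto
    then show ?thesis by (simp only: card.empty mult_0 zero_le)
  qed
  then show ?thesis unfolding settled_def by blast
qed

text \<open>
  The bound holds at every later stage, hence in the limit, for the whole open set.
\<close>

lemma measure_after_settling_time:
  shows "{x. (\<exists>t. Q t x) \<and> \<not> Q (settling_time Q w) x} \<in> sets coin_measure"
    and "measure coin_measure {x. (\<exists>t. Q t x) \<and> \<not> Q (settling_time Q w) x} \<le> 1 / 2 ^ w"
proof -
  let ?s = "settling_time Q w"
  have settled: "settled Q w ?s"
    unfolding settling_time_def using ex_settled by (rule LeastI_ex)
  note lim = measure_ever
  have eq: "{x. (\<exists>t. Q t x) \<and> \<not> Q ?s x} = {x. \<exists>t. Q t x} - {x. Q ?s x}" by auto
  show "{x. (\<exists>t. Q t x) \<and> \<not> Q ?s x} \<in> sets coin_measure"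
    unfolding eq using lim(1) sets_determined_by[OF det] by blast
  have "measure coin_measure {x. Q t x} \<le> measure coin_measure {x. Q ?s x} + 1 / 2 ^ w" if "?s \<le> t" for t
  proof -
    have "real (card {v::nat. v < 2 ^ t \<and> Q t (bit v) \<and> \<not> Q ?s (bit v)} * 2 ^ w) \<le> real (2 ^ t)"
      using settled unfolding settled_def of_nat_le_iff by blast
    then have "measure coin_measure {x. Q t x \<and> \<not> Q ?s x} \<le> 1 / 2 ^ w"
      by (simp add: card_unsettled[OF that] field_simps)
    moreover have "{x. Q t x \<and> \<not> Q ?s x} = {x. Q t x} - {x. Q ?s x}" by auto
    moreover have "{x. Q ?s x} \<subseteq> {x. Q t x}"
      using incr[OF that] by blast
    ultimately show ?thesis
      using sets_determined_by[OF det] by (simp add: coin.finite_measure_Diff)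
  qed
  then have "measure coin_measure {x. \<exists>t. Q t x} \<le> measure coin_measure {x. Q ?s x} + 1 / 2 ^ w"
    by (intro LIMSEQ_le_const2[OF lim(2)]) blast
  then show "measure coin_measure {x. (\<exists>t. Q t x) \<and> \<not> Q ?s x} \<le> 1 / 2 ^ w"
    unfolding eq using lim(1) sets_determined_by[OF det]
    by (subst coin.finite_measure_Diff) auto
qed

end

text \<open>
  Being settled is decidable with one jump, and some stage is settled because the measures converge. So one
  jump suffices to approximate an open set from inside up to a prescribed measure.
\<close>

lemma computable_in_jump_settling_time:
  assumes Q: "decidable_on {Z} (\<lambda>_ z. Q (fst_code z) (fst_code (snd_code z)) (bit (snd_code (snd_code z))))"
    and w: "computable_on {Z} (\<lambda>_. w)"
    and det: "\<And>a t. determined_by t (Q a t)"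
    and incr: "\<And>a s t x. s \<le> t \<Longrightarrow> Q a s x \<Longrightarrow> Q a t x"
  shows "computable_on {jump Z} (\<lambda>_ a. settling_time (Q a) (w a))"
proof -
  have Q': "decidable_on {Z} (\<lambda>_ x. Q (a x) (b x) (bit (c x)))"
    if "computable_on {Z} (\<lambda>_. a)" "computable_on {Z} (\<lambda>_. b)" "computable_on {Z} (\<lambda>_. c)" for a b c
    by (rule computable_on_comp3[where F = "\<lambda>_ a b c. of_bool (Q a b (bit c))", OF Q that])
  have "decidable_on {jump Z} (\<lambda>_ z. settled (Q (fst_code z)) (w (fst_code z)) (snd_code z))"
    unfolding settled_def
    by (rule decidable_in_jump_all) (intro computable Q' computable_on_comp[OF w])
  then show ?thesis
    unfolding settling_time_def
    by (rule computable_on_Least) (rule ex_settled[OF det], erule (1) incr)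
qed

section \<open>The domain and the image of a partial computable map\<close>

text \<open>
  Within bound \<open>t\<close> the first \<open>m\<close> values of the program exist and are binary: the reported results \<open>1\<close> and \<open>2\<close>
  stand for the values \<open>0\<close> and \<open>1\<close>.
\<close>

definition produces :: "prog \<Rightarrow> cantor \<Rightarrow> nat \<Rightarrow> nat \<Rightarrow> bool" where
  "produces p x t m \<longleftrightarrow> (\<forall>i<m. 0 < run_upto x t p i \<and> run_upto x t p i \<le> 2)"

definition outputs :: "prog \<Rightarrow> cantor \<Rightarrow> nat \<Rightarrow> nat \<Rightarrow> cantor \<Rightarrow> bool" where
  "outputs p x t m y \<longleftrightarrow> (\<forall>i<m. run_upto x t p i = Suc (of_bool (y i)))"

lemma produces_iff: "produces p x t m \<longleftrightarrow> (\<exists>y. outputs p x t m y)"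
proof
  assume *: "produces p x t m"
  have "outputs p x t m (\<lambda>i. run_upto x t p i = 2)"
    unfolding outputs_def
  proof (intro allI impI)
    fix i assume "i < m"
    with * have "0 < run_upto x t p i" "run_upto x t p i \<le> 2" by (auto simp: produces_def)
    then consider "run_upto x t p i = 1" | "run_upto x t p i = 2" by linarith
    then show "run_upto x t p i = Suc (of_bool (run_upto x t p i = 2))" by cases simp_all
  qed
  then show "\<exists>y. outputs p x t m y" by (rule exI[of "outputs p x t m"])
next
  assume "\<exists>y. outputs p x t m y"
  then show "produces p x t m" unfolding outputs_def produces_def
    by (metis Suc_leI le_add2 of_bool_less_eq_one one_add_one plus_1_eq_Suc add_le_cancel_left zero_less_Suc)
qed

lemma outputs_mono: "outputs p x s m y \<Longrightarrow> s \<le> t \<Longrightarrow> outputs p x t m y"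
  unfolding outputs_def using run_upto_mono by blast

lemma produces_mono: "produces p x s m \<Longrightarrow> s \<le> t \<Longrightarrow> produces p x t m"
  unfolding produces_iff using outputs_mono by blast

lemma produces_antimono: "produces p x t n \<Longrightarrow> m \<le> n \<Longrightarrow> produces p x t m"
  unfolding produces_def by simp

lemma outputs_run: "outputs p x t m y \<Longrightarrow> i < m \<Longrightarrow> run x p i = Some (of_bool (y i))"
  unfolding outputs_def using run_upto_sound by blast

lemma outputs_unique: "outputs p x t m y \<Longrightarrow> outputs p x t' m' y' \<Longrightarrow> i < m \<Longrightarrow> i < m' \<Longrightarrow> y i = y' i"
proof -
  assume "outputs p x t m y" "outputs p x t' m' y'" "i < m" "i < m'"
  then have "Some (of_bool (y i) :: nat) = Some (of_bool (y' i))"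
    using outputs_run by metis
  then show "y i = y' i" by (simp only: option.inject of_bool_eq_iff)
qed

lemma outputs_cong: "(\<And>i. i < m \<Longrightarrow> y i = y' i) \<Longrightarrow> outputs p x t m y \<Longrightarrow> outputs p x t m y'"
  unfolding outputs_def by simp

lemma outputs_bit_prefix_code: "outputs p x t m (bit (prefix_code y m)) \<longleftrightarrow> outputs p x t m y"
  unfolding outputs_def by (simp add: bit_prefix_code)

lemma outputs_if_produces:
  assumes "outputs p x t' m' y" "produces p x t m" "m \<le> m'"
  shows "outputs p x t m y"
proof -
  from assms(2) obtain y' where y': "outputs p x t m y'" unfolding produces_iff ..
  with assms outputs_unique[OF assms(1) y'] show ?thesis
    by (intro outputs_cong[OF _ y']) simp
qed

lemma outputs_use: "(\<And>i. i < t \<Longrightarrow> x i = x' i) \<Longrightarrow> outputs p x t m y \<Longrightarrow> outputs p x' t m y"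
  unfolding outputs_def using run_upto_use[of t x x' p] by simp

lemma produces_use: "(\<And>i. i < t \<Longrightarrow> x i = x' i) \<Longrightarrow> produces p x t m \<Longrightarrow> produces p x' t m"
  unfolding produces_def using run_upto_use[of t x x' p] by simp

lemma determined_by_produces: "determined_by t (\<lambda>x. produces p x t m)"
  by (rule determined_byI) (rule produces_use)

lemma computable_on_produces [computable]:
  assumes "decidable_on S (\<lambda>A z. X A (fst_code z) (snd_code z))" "computable_on S t" "computable_on S m"
  shows "decidable_on S (\<lambda>A x. produces p (X A x) (t A x) (m A x))"
proof -
  have X: "decidable_on S (\<lambda>A x. X A (f A x) (g A x))"
    if "computable_on S f" "computable_on S g" for f g
    using computable_on_comp2[OF assms(1) that] .
  show ?thesis unfolding produces_def
    by (intro computable X assms computable_on_comp[OF assms(2)])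
qed

lemma computable_on_outputs [computable]:
  assumes "decidable_on S (\<lambda>A z. X A (fst_code z) (snd_code z))" "computable_on S t" "computable_on S m"
    and "decidable_on S (\<lambda>A z. Y A (fst_code z) (snd_code z))"
  shows "decidable_on S (\<lambda>A x. outputs p (X A x) (t A x) (m A x) (Y A x))"
proof -
  have X: "decidable_on S (\<lambda>A x. X A (f A x) (g A x))"
    if "computable_on S f" "computable_on S g" for f g
    using computable_on_comp2[OF assms(1) that] .
  show ?thesis unfolding outputs_def
    by (intro computable X assms computable_on_comp[OF assms(2)])
qed

text \<open>
  The \<open>n\<close>-th open condition on the domain, existence of the first \<open>n\<close> bits of output, is replaced by the
  clopen condition that they appear within \<open>stage p c n\<close>. The weights \<open>n + c\<close> make the total loss of measure
  at most \<open>2 / 2 ^ c\<close>. The remaining set is compact, and its clopen approximations are computable in one jump.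
\<close>

definition stage :: "prog \<Rightarrow> nat \<Rightarrow> nat \<Rightarrow> nat" where
  "stage p c n = settling_time (\<lambda>t x. produces p x t n) (n + c)"

lemma computable_stage: "computable_on {jump empty_real} (\<lambda>_. stage p c)"
  unfolding stage_def
  by (rule computable_in_jump_settling_time[where Q = "\<lambda>n t x. produces p x t n" and w = "\<lambda>n. n + c"])
     (intro computable determined_by_produces | erule produces_mono, assumption)+

definition survives :: "prog \<Rightarrow> nat \<Rightarrow> nat \<Rightarrow> cantor \<Rightarrow> bool" where
  "survives p c n x \<longleftrightarrow> (\<forall>m<Suc n. produces p x (stage p c m) m)"

text \<open>
  The clopen approximation from outside to the image of those surviving points that begin with the string
  \<open>a\<close> of length \<open>l\<close>. The image itself is the intersection over all \<open>n\<close>.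
\<close>

definition image_upto :: "prog \<Rightarrow> nat \<Rightarrow> nat \<Rightarrow> nat \<Rightarrow> nat \<Rightarrow> cantor \<Rightarrow> bool" where
  "image_upto p c l a n y \<longleftrightarrow>
     (\<exists>x. prefix_code x l = a \<and> survives p c n x \<and> outputs p x (stage p c n) n y)"

lemma determined_by_image_upto: "determined_by n (image_upto p c l a n)"
  unfolding image_upto_def by (rule determined_byI) (use outputs_cong in blast)

lemma image_upto_antimono:
  assumes "image_upto p c l a n y" "m \<le> n"
  shows "image_upto p c l a m y"
proof -
  from assms(1) obtain x where x: "prefix_code x l = a" "survives p c n x" "outputs p x (stage p c n) n y"
    unfolding image_upto_def by blast
  have "survives p c m x" using x(2) assms(2) by (simp add: survives_def)
  moreover from this have "produces p x (stage p c m) m" by (simp add: survives_def)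
  then have "outputs p x (stage p c m) m y"
    by (rule outputs_if_produces[OF x(3) _ assms(2)])
  ultimately show ?thesis using x(1) unfolding image_upto_def by blast
qed

lemma image_upto_split:
  assumes "image_upto p c l a n y"
  shows "image_upto p c (Suc l) a n y \<or> image_upto p c (Suc l) (a + 2 ^ l) n y"
proof -
  from assms obtain x where x: "prefix_code x l = a" "survives p c n x" "outputs p x (stage p c n) n y"
    unfolding image_upto_def by blast
  have "prefix_code x (Suc l) = a \<or> prefix_code x (Suc l) = a + 2 ^ l"
    using x(1) by (simp add: prefix_code_def)
  with x(2,3) show ?thesis unfolding image_upto_def by blast
qed

text \<open>
  All conditions on \<open>x\<close> concern its first \<open>l + (\<Sum>m\<le>n. stage p c m)\<close> bits, which turns the search for a real into a
  search for a string.
\<close>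

lemma image_upto_bounded:
  "image_upto p c l a n y \<longleftrightarrow>
     (\<exists>v < 2 ^ (l + (\<Sum>m<Suc n. stage p c m)).
        v mod 2 ^ l = a \<and> (\<forall>m<Suc n. produces p (bit v) (stage p c m) m) \<and>
        outputs p (bit v) (stage p c n) n y)"
    (is "_ \<longleftrightarrow> (\<exists>v < 2 ^ ?k. _)")
proof
  assume "image_upto p c l a n y"
  then obtain x where x: "prefix_code x l = a" "survives p c n x" "outputs p x (stage p c n) n y"
    unfolding image_upto_def by blast
  let ?v = "prefix_code x ?k"
  have le: "stage p c m \<le> ?k" if "m < Suc n" for m
  proof -
    have "stage p c m \<le> (\<Sum>m<Suc n. stage p c m)" using that by (intro member_le_sum) auto
    then show ?thesis by simp
  qed
  have "?v < 2 ^ ?k" by (rule prefix_code_less)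
  moreover have "?v mod 2 ^ l = a" using x(1) by (simp add: prefix_code_mod)
  moreover have "\<forall>m<Suc n. produces p (bit ?v) (stage p c m) m"
  proof (intro allI impI)
    fix m assume m: "m < Suc n"
    with x(2) have "produces p x (stage p c m) m" by (simp add: survives_def)
    then show "produces p (bit ?v) (stage p c m) m"
      using le[OF m] by (elim produces_use[rotated]) (simp add: bit_prefix_code)
  qed
  moreover have "outputs p (bit ?v) (stage p c n) n y"
    using x(3) le[of n] by (elim outputs_use[rotated]) (simp add: bit_prefix_code)
  ultimately show "\<exists>v < 2 ^ ?k. v mod 2 ^ l = a \<and> (\<forall>m<Suc n. produces p (bit v) (stage p c m) m) \<and>
        outputs p (bit v) (stage p c n) n y" by blast
next
  assume "\<exists>v < 2 ^ ?k. v mod 2 ^ l = a \<and> (\<forall>m<Suc n. produces p (bit v) (stage p c m) m) \<and>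
        outputs p (bit v) (stage p c n) n y"
  then show "image_upto p c l a n y"
    unfolding image_upto_def survives_def by (metis prefix_code_bit)
qed

lemma computable_on_image_upto:
  assumes "computable_on S (\<lambda>_. stage p c)"
    and "computable_on S l" "computable_on S a" "computable_on S n"
    and "decidable_on S (\<lambda>A z. Y A (fst_code z) (snd_code z))"
  shows "decidable_on S (\<lambda>A x. image_upto p c (l A x) (a A x) (n A x) (Y A x))"
proof -
  have Y: "decidable_on S (\<lambda>A x. Y A (f A x) (g A x))"
    if "computable_on S f" "computable_on S g" for f g
    using computable_on_comp2[OF assms(5) that] .
  show ?thesis unfolding image_upto_bounded
    by (intro computable Y assms computable_on_comp[OF assms(1)] computable_on_comp[OF assms(2)]
        computable_on_comp[OF assms(3)] computable_on_comp[OF assms(4)])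
qed

section \<open>Martin-Loef tests\<close>

definition drop_code :: "nat \<Rightarrow> nat \<Rightarrow> nat" where
  "drop_code c i = rec_nat c (\<lambda>_ r. snd_code (r - 1)) i"

lemma drop_code_list_encode: "drop_code (list_encode xs) i = list_encode (drop i xs)"
proof (induction i)
  case (Suc i)
  have *: "snd_code (list_encode ys - 1) = list_encode (tl ys)" for ys
  proof (cases ys)
    case Nil
    have "prod_encode (0, 0) = 0" by (simp add: prod_encode_def)
    then have "prod_decode 0 = (0, 0)" using prod_encode_inverse[of "(0, 0)"] by simp
    with Nil show ?thesis by simp
  qed simp
  have "drop_code (list_encode xs) (Suc i) = snd_code (drop_code (list_encode xs) i - 1)"
    by (simp add: drop_code_def)
  also have "\<dots> = list_encode (drop (Suc i) xs)"
    unfolding Suc.IH * by (simp add: tl_drop drop_Suc)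
  finally show ?case .
qed (simp add: drop_code_def)

lemma list_encode_eq_0: "list_encode xs = 0 \<longleftrightarrow> xs = []"
  by (cases xs) simp_all

text \<open>
  Translation from the list codes of strings used in Martin-Loef tests to the binary codes used here: \<open>c\<close> is the
  list code of a string of length \<open>m\<close> whose binary code is \<open>v\<close>.
\<close>

definition codes_string :: "nat \<Rightarrow> nat \<Rightarrow> nat \<Rightarrow> bool" where
  "codes_string c m v \<longleftrightarrow> drop_code c m = 0 \<and> (\<forall>i<m. 0 < drop_code c i) \<and>
     v = (\<Sum>i<m. fst_code (drop_code c i - 1) * 2 ^ i)"

lemma codes_string: "codes_string (string_code s) m v \<longleftrightarrow> length s = m \<and> v = horner_sum of_bool 2 s"
proof -
  have eq: "(\<Sum>i<length s. fst_code (drop_code (string_code s) i - 1) * 2 ^ i) = horner_sum of_bool 2 s"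
    unfolding horner_sum_eq_sum atLeast0LessThan
  proof (rule sum.cong)
    fix i assume "i \<in> {..<length s}"
    then have "drop i (map of_bool s) = of_bool (s ! i) # drop (Suc i) (map of_bool s :: nat list)"
      by (metis Cons_nth_drop_Suc length_map lessThan_iff nth_map)
    then show "fst_code (drop_code (string_code s) i - 1) * 2 ^ i = of_bool (s ! i) * 2 ^ i"
      by (simp add: string_code_def drop_code_list_encode)
  qed simp
  have zero: "drop_code (string_code s) i = 0 \<longleftrightarrow> length s \<le> i" for i
    by (simp add: string_code_def drop_code_list_encode list_encode_eq_0)
  have "length s \<le> m \<and> (\<forall>i<m. i < length s) \<longleftrightarrow> length s = m"
  proof -
    have "(\<forall>i<m. i < length s) \<longleftrightarrow> m \<le> length s"
      by (meson leI less_irrefl less_le_trans)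
    then show ?thesis by (simp only:) (rule order.eq_iff[symmetric])
  qed
  then have len: "drop_code (string_code s) m = 0 \<and> (\<forall>i<m. 0 < drop_code (string_code s) i) \<longleftrightarrow> length s = m"
    by (simp only: zero neq0_conv[symmetric] not_le)
  show ?thesis
    unfolding codes_string_def conj_assoc[symmetric] len using eq by (cases "length s = m") simp_all
qed

lemma mem_cylinder: "y \<in> cylinder s \<longleftrightarrow> prefix_code y (length s) = horner_sum of_bool 2 s"
proof -
  have "horner_sum of_bool 2 s < (2 ^ length s :: nat)"
    by (rule horner_sum_of_bool_2_less)
  from prefix_code_eq_iff[OF this, of y] show ?thesis
    by (simp add: cylinder_def bit_horner_sum_bit_iff)
qed

text \<open>
  A computable sequence of clopen sets of measures at most \<open>1 / 2 ^ n\<close> is a Solovay test; its tail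
  unions form a Martin-Loef test since the measures beyond \<open>k\<close> add up to \<open>1 / 2 ^ k\<close>. In the enumeration,
  the witness \<open>w\<close> codes the number \<open>n > k\<close> together with the binary code of the enumerated string.
\<close>

lemma mltest_tails:
  fixes m u :: "nat \<Rightarrow> nat"
  assumes m: "computable_on {empty_real} (\<lambda>_. m)" and u: "computable_on {empty_real} (\<lambda>_. u)"
    and small: "\<And>n. measure coin_measure {y. bit (u n) (prefix_code y (m n))} \<le> 1 / 2 ^ n"
  shows "mltest (\<lambda>k. {y. \<exists>n>k. bit (u n) (prefix_code y (m n))})"
proof -
  let ?R = "\<lambda>z w. fst_code z < fst_code w \<and> snd_code w < 2 ^ m (fst_code w) \<and> bit (u (fst_code w)) (snd_code w) \<and>
      codes_string (snd_code z) (m (fst_code w)) (snd_code w)"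
  have "decidable_on {empty_real} (\<lambda>_ z. ?R (fst_code z) (snd_code z))"
    unfolding codes_string_def drop_code_def
    by (intro computable computable_on_comp[OF m] computable_on_comp[OF u])
  then obtain p where p: "\<And>z. halts empty_real p z \<longleftrightarrow> (\<exists>w. ?R z w)"
    using semidecidable[where R = ?R] by blast
  let ?W = "{z. \<exists>w. ?R z w}"
  have "comp_enumerable ?W"
    unfolding comp_enumerable_def by (rule exI[of _ p], rule Collect_cong, rule p[symmetric])
  moreover have "{y. \<exists>n>k. bit (u n) (prefix_code y (m n))} =
    (\<Union>s \<in> {s. prod_encode (k, string_code s) \<in> ?W}. cylinder s)" (is "?l = ?r") for k
  proof
    show "?l \<subseteq> ?r"
    proof
      fix y assume "y \<in> ?l"
      then obtain n where n: "k < n" "bit (u n) (prefix_code y (m n))" by blast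
      let ?s = "map y [0..<m n]"
      have s: "prefix_code y (m n) = horner_sum of_bool 2 ?s" by (rule prefix_code_horner)
      have "?R (prod_encode (k, string_code ?s)) (prod_encode (n, prefix_code y (m n)))"
        using n prefix_code_less[of y "m n"] by (simp add: codes_string s)
      moreover have "y \<in> cylinder ?s" using s by (simp add: mem_cylinder)
      ultimately show "y \<in> ?r" by blast
    qed
    show "?r \<subseteq> ?l"
    proof
      fix y assume "y \<in> ?r"
      then obtain s w where w: "?R (prod_encode (k, string_code s)) w" and y: "y \<in> cylinder s" by blast
      from w y show "y \<in> ?l"
        by (auto simp: codes_string mem_cylinder)
    qed
  qed
  moreover have "measure coin_measure {y. \<exists>n>k. bit (u n) (prefix_code y (m n))} \<le> 1 / 2 ^ k" for k
  proof -
    have eq: "{y. \<exists>n>k. bit (u n) (prefix_code y (m n))} =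
        (\<Union>i. {y. bit (u (Suc k + i)) (prefix_code y (m (Suc k + i)))})"
    proof -
      have "(\<exists>n>k. P n) \<longleftrightarrow> (\<exists>i. P (Suc k + i))" for P
        by (metis add_Suc less_add_Suc1 less_imp_Suc_add)
      then show ?thesis by (simp only: Collect_ex_eq)
    qed
    have "measure coin_measure \<dots> \<le> 2 * (1 / 2 ^ Suc k)"
    proof (rule measure_union_le)
      show "measure coin_measure {y. bit (u (Suc k + i)) (prefix_code y (m (Suc k + i)))} \<le> 1 / 2 ^ Suc k / 2 ^ i"
        for i using small[of "Suc k + i"] by (simp add: power_add)
    qed (rule sets_prefix_code)
    then show ?thesis unfolding eq by simp
  qed
  ultimately show ?thesis unfolding mltest_def by blast
qed

text \<open>
  The reverse Fatou inequality for sets.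
\<close>

lemma measure_limsup_ge:
  fixes E :: "nat \<Rightarrow> cantor set"
  assumes "\<And>n. E n \<in> sets coin_measure" "\<And>n. r \<le> measure coin_measure (E n)"
  shows "r \<le> measure coin_measure (\<Inter>k. \<Union>n\<in>{k<..}. E n)"
proof (rule LIMSEQ_le_const)
  show "(\<lambda>k. measure coin_measure (\<Union>n\<in>{k<..}. E n)) \<longlonglongrightarrow> measure coin_measure (\<Inter>k. \<Union>n\<in>{k<..}. E n)"
  proof (rule coin.finite_Lim_measure_decseq)
    show "decseq (\<lambda>k. \<Union>n\<in>{k<..}. E n)"
      unfolding decseq_def by (intro allI impI UN_mono) auto
  qed (use assms(1) in auto)
  have "r \<le> measure coin_measure (\<Union>n\<in>{k<..}. E n)" for k
    using assms(1) by (intro order_trans[OF assms(2)[of "Suc k"]] coin.finite_measure_mono) auto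
  then show "\<exists>N. \<forall>k\<ge>N. r \<le> measure coin_measure (\<Union>n\<in>{k<..}. E n)" by blast
qed

section \<open>The image of a large compact set has positive measure\<close>

locale computed_map =
  fixes f :: "cantor \<rightharpoonup> cantor" and p :: prog
  assumes dom: "x \<in> dom f \<longleftrightarrow> (\<forall>n. halts x p n)"
    and run: "x \<in> dom f \<Longrightarrow> run x p n = Some (of_bool (the (f x) n))"
begin

lemma ex_outputs: "x \<in> dom f \<Longrightarrow> \<exists>t. outputs p x t m (the (f x))"
proof (induction m)
  case 0
  then show ?case by (simp add: outputs_def)
next
  case (Suc m)
  then obtain t where t: "outputs p x t m (the (f x))" by blast
  obtain t' where t': "run_upto x t' p m = Suc (of_bool (the (f x) m))"
    using run_upto_complete[OF run[OF Suc.prems]] by blast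
  have "outputs p x (max t t') (Suc m) (the (f x))"
    using outputs_mono[OF t, of "max t t'"] run_upto_mono[OF t', of "max t t'"]
    by (simp add: outputs_def less_Suc_eq)
  then show ?case ..
qed

lemma dom_iff: "x \<in> dom f \<longleftrightarrow> (\<forall>m. \<exists>t. produces p x t m)"
proof
  assume "x \<in> dom f"
  then show "\<forall>m. \<exists>t. produces p x t m" using ex_outputs produces_iff by blast
next
  assume *: "\<forall>m. \<exists>t. produces p x t m"
  have "halts x p n" for n
    using *[rule_format, of "Suc n"] outputs_run unfolding produces_iff halts_def by fastforce
  then show "x \<in> dom f" by (simp add: dom)
qed

lemma outputs_dom: "x \<in> dom f \<Longrightarrow> outputs p x t m y \<Longrightarrow> i < m \<Longrightarrow> the (f x) i = y i"
proof -
  assume "x \<in> dom f" "outputs p x t m y" "i < m"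
  then have "Some (of_bool (the (f x) i) :: nat) = Some (of_bool (y i))"
    using run outputs_run by metis
  then show "the (f x) i = y i" by (simp only: option.inject of_bool_eq_iff)
qed

lemma measure_domain:
  shows "dom f \<in> sets coin_measure"
    and "{x. \<exists>t. produces p x t m} \<in> sets coin_measure"
    and "(\<lambda>m. measure coin_measure {x. \<exists>t. produces p x t m}) \<longlonglongrightarrow> measure coin_measure (dom f)"
proof -
  have sets: "{x. \<exists>t. produces p x t m} \<in> sets coin_measure" for m
    by (rule measure_increasing_union(1)[OF determined_by_produces]) (rule produces_mono)
  then show "{x. \<exists>t. produces p x t m} \<in> sets coin_measure" .
  have eq: "dom f = (\<Inter>m. {x. \<exists>t. produces p x t m})"
    unfolding set_eq_iff dom_iff by blast
  show "dom f \<in> sets coin_measure"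
    unfolding eq using sets by auto
  show "(\<lambda>m. measure coin_measure {x. \<exists>t. produces p x t m}) \<longlonglongrightarrow> measure coin_measure (dom f)"
    unfolding eq using sets produces_antimono
    by (intro coin.finite_Lim_measure_decseq) (auto simp: decseq_def, blast)
qed

text \<open>
  If for every \<open>n\<close> some clopen \<open>U\<close> of measure at most \<open>1 / 2 ^ n\<close> received more than measure \<open>a / b\<close> of inputs, then such
  clopen sets could be found by computable search, as all conditions on them are inequalities between finite counts.
  The inputs sent into infinitely many of them have measure at least \<open>a / b\<close>. As \<open>U\<close> is described by
  \<open>m \<ge> N\<close> bits, these inputs lie in the open set \<open>D\<close> where the first \<open>N\<close> bits of output exist, and
  so does \<open>A\<close>. Since \<open>measure D - measure A < a / b\<close>, some point of \<open>A\<close> is among them, and its image fails the resulting test. Restricting to \<open>D\<close> is what allows the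
  search to ignore whether inputs that produce \<open>m\<close> bits belong to the domain.
\<close>

lemma no_small_images:
  fixes a b N :: nat
  assumes A: "A \<in> sets coin_measure" "A \<subseteq> dom f" "\<And>x. x \<in> A \<Longrightarrow> the (f x) \<in> MLrandom"
    and ab: "0 < b" "measure coin_measure {x. \<exists>t. produces p x t N} - measure coin_measure A < a / b"
    and ex: "\<And>n. \<exists>m\<ge>N. \<exists>u t. measure coin_measure {y. bit (u::nat) (prefix_code y m)} \<le> 1 / 2 ^ n \<and>
      a / b < measure coin_measure {x. \<exists>v<2 ^ m. bit u v \<and> outputs p x t m (bit v)}"
  shows False
proof -
  define Q where "Q n m t u \<longleftrightarrow> N \<le> m \<and> card {v. v < 2 ^ m \<and> bit u v} * 2 ^ n \<le> 2 ^ m \<and>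
     a * 2 ^ t < b * card {w::nat. w < 2 ^ t \<and> (\<exists>v<2 ^ m. bit u v \<and> outputs p (bit w) t m (bit v))}"
    for n m t u :: nat
  have mU: "measure coin_measure {y. bit (u::nat) (prefix_code y m)} = card {v. v < 2 ^ m \<and> bit u v} / 2 ^ m"
    for u m by (rule measure_prefix_code)
  have det: "determined_by t (\<lambda>x. \<exists>v<2 ^ m. bit u v \<and> outputs p x t m (bit v))" for u t m :: nat
    by (rule determined_byI) (use outputs_use in blast)
  have Q_iff: "Q n m t u \<longleftrightarrow> N \<le> m \<and> measure coin_measure {y. bit u (prefix_code y m)} \<le> 1 / 2 ^ n \<and>
      a / b < measure coin_measure {x. \<exists>v<2 ^ m. bit u v \<and> outputs p x t m (bit v)}" for n m t u
  proof -
    have "real (card {v. v < 2 ^ m \<and> bit u v}) / 2 ^ m \<le> 1 / 2 ^ n \<longleftrightarrow>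
       real (card {v. v < 2 ^ m \<and> bit u v} * 2 ^ n) \<le> real (2 ^ m)"
      by (simp add: field_simps)
    moreover have "a / b < real k / 2 ^ t \<longleftrightarrow> real (a * 2 ^ t) < real (b * k)" for k
      using ab(1) by (simp add: field_simps)
    ultimately show ?thesis
      unfolding Q_def measure_determined_by[OF det] mU of_nat_le_iff of_nat_less_iff by simp
  qed
  define P where "P n w \<longleftrightarrow> Q n (fst_code w) (fst_code (snd_code w)) (snd_code (snd_code w))" for n w
  define w where "w n = (LEAST w. P n w)" for n
  have ex_P: "\<exists>w. P n w" for n
  proof -
    from ex[of n] obtain m t u where "Q n m t u" unfolding Q_iff by blast
    then have "P n (prod_encode (m, prod_encode (t, u)))" by (simp add: P_def)
    then show ?thesis by blast
  qed
  have w: "P n (w n)" for n unfolding w_def by (rule LeastI_ex[OF ex_P])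
  have "decidable_on {empty_real} (\<lambda>_ z. P (fst_code z) (snd_code z))"
    unfolding P_def Q_def by (intro computable)
  then have comp_w: "computable_on {empty_real} (\<lambda>_. w)"
    unfolding w_def by (rule computable_on_Least) (rule ex_P)
  define m where "m n = fst_code (w n)" for n
  define t where "t n = fst_code (snd_code (w n))" for n
  define u where "u n = snd_code (snd_code (w n))" for n
  have mtu: "N \<le> m n" "measure coin_measure {y. bit (u n) (prefix_code y (m n))} \<le> 1 / 2 ^ n"
    "a / b < measure coin_measure {x. \<exists>v<2 ^ m n. bit (u n) v \<and> outputs p x (t n) (m n) (bit v)}" for n
    using w[of n] unfolding P_def Q_iff m_def t_def u_def by blast+
  have "computable_on {empty_real} (\<lambda>_. m)" "computable_on {empty_real} (\<lambda>_. u)"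
    unfolding m_def u_def by (intro computable computable_on_comp[OF comp_w])+
  from mltest_tails[OF this mtu(2)]
  have test: "mltest (\<lambda>k. {y. \<exists>n>k. bit (u n) (prefix_code y (m n))})" .
  define E where "E n = {x. \<exists>v<2 ^ m n. bit (u n) v \<and> outputs p x (t n) (m n) (bit v)}" for n
  let ?L = "\<Inter>k. \<Union>n\<in>{k<..}. E n"
  have E: "E n \<in> sets coin_measure" for n
    unfolding E_def by (rule sets_determined_by[OF det])
  then have L: "?L \<in> sets coin_measure" by auto
  have r: "a / b \<le> measure coin_measure ?L"
    using E mtu(3) by (intro measure_limsup_ge) (auto simp: E_def intro: less_imp_le)
  have "E n \<subseteq> {x. \<exists>t. produces p x t N}" for n
    unfolding E_def using mtu(1)[of n] produces_antimono produces_iff by blast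
  then have LD: "?L \<subseteq> {x. \<exists>t. produces p x t N}" by blast
  have AD: "A \<subseteq> {x. \<exists>t. produces p x t N}" using A(2) dom_iff by blast
  have "A \<inter> ?L \<noteq> {}"
  proof
    assume "A \<inter> ?L = {}"
    then have "measure coin_measure A + measure coin_measure ?L = measure coin_measure (A \<union> ?L)"
      using A(1) L by (simp add: coin.finite_measure_Union)
    also have "\<dots> \<le> measure coin_measure {x. \<exists>t. produces p x t N}"
      using LD AD measure_domain(2) by (intro coin.finite_measure_mono) auto
    finally show False using r ab(2) by linarith
  qed
  then obtain x where x: "x \<in> A" "x \<in> ?L" by blast
  then have dom_x: "x \<in> dom f" using A(2) by blast
  have "\<exists>n>k. bit (u n) (prefix_code (the (f x)) (m n))" for k
  proof -
    from x(2) obtain n where n: "k < n" "x \<in> E n" by blast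
    then obtain v where v: "v < 2 ^ m n" "bit (u n) v" "outputs p x (t n) (m n) (bit v)"
      unfolding E_def by blast
    have "prefix_code (the (f x)) (m n) = v"
      using v(1) outputs_dom[OF dom_x v(3)] by (simp add: prefix_code_eq_iff)
    with n(1) v(2) show ?thesis by blast
  qed
  then have "the (f x) \<in> (\<Inter>k. {y. \<exists>n>k. bit (u n) (prefix_code y (m n))})" by blast
  with test A(3)[OF x(1)] show False unfolding MLrandom_def by blast
qed

lemma measure_survivors:
  shows "{x. \<forall>n. produces p x (stage p c n) n} \<in> sets coin_measure"
    and "measure coin_measure (dom f) - 2 / 2 ^ c \<le> measure coin_measure {x. \<forall>n. produces p x (stage p c n) n}"
proof -
  let ?K = "{x. \<forall>n. produces p x (stage p c n) n}"
  let ?B = "\<lambda>n. {x. (\<exists>t. produces p x t n) \<and> \<not> produces p x (stage p c n) n}"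
  have "?K = (\<Inter>n. {x. produces p x (stage p c n) n})" by auto
  also have "\<dots> \<in> sets coin_measure"
    using sets_determined_by[OF determined_by_produces] by auto
  finally show K: "?K \<in> sets coin_measure" .
  have B: "?B n \<in> sets coin_measure" "measure coin_measure (?B n) \<le> 1 / 2 ^ (n + c)" for n
    unfolding stage_def
    by (rule measure_after_settling_time[of "\<lambda>t x. produces p x t n", OF determined_by_produces],
        erule (1) produces_mono)+
  have "measure coin_measure (\<Union>n. ?B n) \<le> 2 * (1 / 2 ^ c)"
    by (rule measure_union_le) (use B in \<open>auto simp: power_add mult.commute\<close>)
  moreover have "measure coin_measure (dom f) \<le> measure coin_measure (?K \<union> (\<Union>n. ?B n))"
  proof (rule coin.finite_measure_mono)
    show "dom f \<subseteq> ?K \<union> (\<Union>n. ?B n)"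
      unfolding subset_iff dom_iff by blast
    show "?K \<union> (\<Union>n. ?B n) \<in> sets coin_measure"
      using K B(1) by blast
  qed
  moreover have "\<dots> \<le> measure coin_measure ?K + measure coin_measure (\<Union>n. ?B n)"
    using K B(1) by (intro measure_Un_le) auto
  ultimately show "measure coin_measure (dom f) - 2 / 2 ^ c \<le> measure coin_measure ?K"
    by simp
qed

text \<open>
  For large \<open>c\<close> the surviving compact set \<open>K\<close> misses less than a third of the measure of \<open>A\<close> from the domain, and
  for large \<open>N\<close> the domain exhausts the set of points producing \<open>N\<close> bits equally well, so a rational
  fits between \<open>measure D - measure A\<close> and \<open>measure K\<close>. If the image of \<open>K\<close> were null, its clopen approximations would have
  arbitrarily small measure while receiving all of \<open>K\<close>.
\<close>

lemma positive_measure_image: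
  assumes A: "A \<in> sets coin_measure" "A \<subseteq> dom f" "\<And>x. x \<in> A \<Longrightarrow> the (f x) \<in> MLrandom"
    and pos: "0 < measure coin_measure A"
  obtains c where "0 < measure coin_measure {y. \<forall>n. image_upto p c 0 0 n y}"
proof -
  let ?\<alpha> = "measure coin_measure A"
  obtain c where "(1 / 2) ^ c < ?\<alpha> / 6"
    using real_arch_pow_inv[of "?\<alpha> / 6" "1 / 2"] pos by auto
  then have c: "2 / 2 ^ c < ?\<alpha> / 3" by (simp add: power_one_over)
  let ?D = "\<lambda>m. {x. \<exists>t. produces p x t m}"
  have "\<forall>\<^sub>F m in sequentially. measure coin_measure (?D m) < measure coin_measure (dom f) + ?\<alpha> / 3"
    using pos by (intro order_tendstoD(2)[OF measure_domain(3)]) simp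
  then obtain N where N: "measure coin_measure (?D N) < measure coin_measure (dom f) + ?\<alpha> / 3"
    using eventually_happens'[OF sequentially_bot] by blast
  let ?K = "{x. \<forall>n. produces p x (stage p c n) n}"
  have K: "measure coin_measure (?D N) - ?\<alpha> < measure coin_measure ?K"
    using measure_survivors(2)[of c] c N pos by linarith
  have "?\<alpha> \<le> measure coin_measure (?D N)"
  proof (rule coin.finite_measure_mono)
    show "A \<subseteq> ?D N" using A(2) unfolding subset_iff dom_iff by blast
  qed (rule measure_domain(2))
  moreover obtain q where q: "q \<in> \<rat>" "measure coin_measure (?D N) - ?\<alpha> < q" "q < measure coin_measure ?K"
    using Rats_dense_in_real[OF K] by blast
  ultimately have "0 \<le> q" by linarith
  with q(1) obtain a b :: nat where ab: "b \<noteq> 0" "q = a / b"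
    using Rats_abs_nat_div_natE by (metis abs_of_nonneg)
  have "0 < measure coin_measure {y. \<forall>n. image_upto p c 0 0 n y}"
  proof (rule ccontr)
    assume "\<not> ?thesis"
    then have null: "measure coin_measure {y. \<forall>n. image_upto p c 0 0 n y} = 0"
      by (simp add: zero_less_measure_iff)
    have lim: "(\<lambda>n. measure coin_measure {y. image_upto p c 0 0 n y}) \<longlonglongrightarrow> 0"
      unfolding null[symmetric]
      by (rule measure_decreasing_inter(2)[OF determined_by_image_upto]) (rule image_upto_antimono)
    show False
    proof (rule no_small_images[OF A])
      show "0 < b" using ab(1) by simp
      show "measure coin_measure (?D N) - ?\<alpha> < a / b" using q(2) ab(2) by simp
      fix n
      have "\<forall>\<^sub>F m in sequentially. measure coin_measure {y. image_upto p c 0 0 m y} < 1 / 2 ^ n"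
        by (rule order_tendstoD(2)[OF lim]) simp
      moreover have "\<forall>\<^sub>F m in sequentially. N \<le> m" by (rule eventually_ge_at_top)
      ultimately have "\<forall>\<^sub>F m in sequentially. N \<le> m \<and> measure coin_measure {y. image_upto p c 0 0 m y} < 1 / 2 ^ n"
        by (rule eventually_conj[rotated])
      then obtain m where m: "N \<le> m" "measure coin_measure {y. image_upto p c 0 0 m y} < 1 / 2 ^ n"
        using eventually_happens'[OF sequentially_bot] by blast
      \<comment> \<open>The set of strings of length \<open>m\<close> in the approximation, as the set of binary digits of a number.\<close>
      define u where "u = set_encode {v. v < 2 ^ m \<and> image_upto p c 0 0 m (bit v)}"
      have u: "bit u v \<longleftrightarrow> v < 2 ^ m \<and> image_upto p c 0 0 m (bit v)" for v
      proof -
        have "bit u v \<longleftrightarrow> v \<in> set_decode u" by (simp add: set_decode_def bit_iff_odd)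
        then show ?thesis by (simp add: u_def set_encode_inverse)
      qed
      have "{y. bit u (prefix_code y m)} = {y. image_upto p c 0 0 m y}"
        using determined_by_image_upto[of m p c 0 0] by (simp add: u determined_by_def prefix_code_less)
      with m(2) have small: "measure coin_measure {y. bit u (prefix_code y m)} \<le> 1 / 2 ^ n" by simp
      let ?t = "stage p c m"
      have "?K \<subseteq> {x. \<exists>v<2 ^ m. bit u v \<and> outputs p x ?t m (bit v)}"
      proof
        fix x assume x: "x \<in> ?K"
        then obtain y where y: "outputs p x ?t m y" unfolding produces_iff by blast
        let ?v = "prefix_code y m"
        have out: "outputs p x ?t m (bit ?v)" using y by (simp add: outputs_bit_prefix_code)
        have "image_upto p c 0 0 m (bit ?v)"
          unfolding image_upto_def survives_def
          using x out by (intro exI[of _ x]) (simp add: prefix_code_def)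
        with out show "x \<in> {x. \<exists>v<2 ^ m. bit u v \<and> outputs p x ?t m (bit v)}"
          using prefix_code_less[of y m] u by blast
      qed
      then have "measure coin_measure ?K \<le> measure coin_measure {x. \<exists>v<2 ^ m. bit u v \<and> outputs p x ?t m (bit v)}"
        by (rule coin.finite_measure_mono)
           (rule sets_determined_by[of ?t], rule determined_byI, use outputs_use in blast)
      with q(3) ab(2) have "a / b < measure coin_measure {x. \<exists>v<2 ^ m. bit u v \<and> outputs p x ?t m (bit v)}"
        by linarith
      with small m(1)
      show "\<exists>m\<ge>N. \<exists>u t. measure coin_measure {y. bit (u::nat) (prefix_code y m)} \<le> 1 / 2 ^ n \<and>
        a / b < measure coin_measure {x. \<exists>v<2 ^ m. bit u v \<and> outputs p x t m (bit v)}"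
        by blast
    qed
  qed
  then show thesis by (rule that)
qed

end

section \<open>The leftmost preimage\<close>

text \<open>
  The complements of \<open>image_upto p c l a n\<close> increase with \<open>n\<close>, so a second jump finds a level at which the
  approximation to the image exceeds it by at most \<open>1 / 2 ^ (2 * l + d)\<close>. The \<open>2 ^ l\<close> strings of length \<open>l\<close>
  together then contribute at most \<open>1 / 2 ^ (l + d)\<close>, which is summable.
\<close>

definition depth :: "prog \<Rightarrow> nat \<Rightarrow> nat \<Rightarrow> nat \<Rightarrow> nat \<Rightarrow> nat" where
  "depth p c d l a = settling_time (\<lambda>n y. \<not> image_upto p c l a n y) (2 * l + d)"

lemma determined_by_not_image_upto: "determined_by n (\<lambda>y. \<not> image_upto p c l a n y)"
  using determined_by_image_upto[of n p c l a] by (simp add: determined_by_def)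

lemma computable_depth:
  "computable_on {jump (jump empty_real)} (\<lambda>_ z. depth p c d (fst_code z) (snd_code z))"
  unfolding depth_def
proof (rule computable_in_jump_settling_time[where
    Q = "\<lambda>z n y. \<not> image_upto p c (fst_code z) (snd_code z) n y" and w = "\<lambda>z. 2 * fst_code z + d"])
  show "decidable_on {jump empty_real} (\<lambda>_ z. \<not> image_upto p c (fst_code (fst_code z)) (snd_code (fst_code z))
      (fst_code (snd_code z)) (bit (snd_code (snd_code z))))"
    by (intro computable computable_on_image_upto computable_stage)
  show "computable_on {jump empty_real} (\<lambda>_ z. 2 * fst_code z + d)"
    by (intro computable)
  show "determined_by n (\<lambda>y. \<not> image_upto p c (fst_code z) (snd_code z) n y)" for z n
    by (rule determined_by_not_image_upto)
  show "\<not> image_upto p c (fst_code z) (snd_code z) n y" if "m \<le> n" "\<not> image_upto p c (fst_code z) (snd_code z) m y"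
    for z m n y
    using that image_upto_antimono by blast
qed

text \<open>
  The approximations contain the image, so an error can only consist in accepting \<open>y\<close> wrongly.
\<close>

definition misjudged :: "prog \<Rightarrow> nat \<Rightarrow> nat \<Rightarrow> cantor set" where
  "misjudged p c d = {y. \<exists>l. \<exists>a<2 ^ l. image_upto p c l a (depth p c d l a) y \<and> (\<exists>n. \<not> image_upto p c l a n y)}"

lemma measure_misjudged:
  shows "misjudged p c d \<in> sets coin_measure"
    and "measure coin_measure (misjudged p c d) \<le> 2 / 2 ^ d"
proof -
  let ?B = "\<lambda>l a. {y. (\<exists>n. \<not> image_upto p c l a n y) \<and> \<not> \<not> image_upto p c l a (depth p c d l a) y}"
  have B: "?B l a \<in> sets coin_measure" "measure coin_measure (?B l a) \<le> 1 / 2 ^ (2 * l + d)" for l a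
    unfolding depth_def
    by (rule measure_after_settling_time[of "\<lambda>n y. \<not> image_upto p c l a n y", OF determined_by_not_image_upto],
        erule contrapos_nn, erule (1) image_upto_antimono)+
  have eq: "misjudged p c d = (\<Union>l. \<Union>a\<in>{..<2 ^ l}. ?B l a)"
    unfolding misjudged_def by blast
  have sets: "(\<Union>a\<in>{..<2 ^ l}. ?B l a) \<in> sets coin_measure" for l
    using B(1) by blast
  then show "misjudged p c d \<in> sets coin_measure" unfolding eq by blast
  have "measure coin_measure (\<Union>a\<in>{..<2 ^ l}. ?B l a) \<le> 1 / 2 ^ d / 2 ^ l" for l
  proof -
    have "measure coin_measure (\<Union>a\<in>{..<2 ^ l}. ?B l a) \<le> (\<Sum>a\<in>{..<2 ^ l}. measure coin_measure (?B l a))"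
      using B(1) by (intro measure_UNION_le) auto
    also have "\<dots> \<le> (\<Sum>a\<in>{..<2 ^ l :: nat}. 1 / 2 ^ (2 * l + d))"
      using B(2) by (intro sum_mono)
    also have "\<dots> = 1 / 2 ^ d / 2 ^ l"
      by (simp add: power_add power_mult power2_eq_square mult_2 power_mult_distrib)
    finally show ?thesis .
  qed
  then have "measure coin_measure (misjudged p c d) \<le> 2 * (1 / 2 ^ d)"
    unfolding eq using sets by (intro measure_union_le)
  then show "measure coin_measure (misjudged p c d) \<le> 2 / 2 ^ d" by simp
qed

text \<open>
  The string of length \<open>l\<close> obtained by always going left if the approximation at the chosen depth admits a preimage
  there. Appending the bit 1 to a string of length \<open>l\<close> adds \<open>2 ^ l\<close> to its code.
\<close>

definition branch :: "prog \<Rightarrow> nat \<Rightarrow> nat \<Rightarrow> cantor \<Rightarrow> nat \<Rightarrow> nat" where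
  "branch p c d y l = rec_nat 0 (\<lambda>l a.
     if image_upto p c (Suc l) a (depth p c d (Suc l) a) y then a else a + 2 ^ l) l"

lemma branch_0: "branch p c d y 0 = 0"
  by (simp add: branch_def)

lemma branch_Suc: "branch p c d y (Suc l) =
   (if image_upto p c (Suc l) (branch p c d y l) (depth p c d (Suc l) (branch p c d y l)) y
    then branch p c d y l else branch p c d y l + 2 ^ l)"
  by (simp add: branch_def)

definition leftmost :: "prog \<Rightarrow> nat \<Rightarrow> nat \<Rightarrow> cantor \<Rightarrow> cantor" where
  "leftmost p c d y = (\<lambda>n. bit (branch p c d y (Suc n)) n)"

lemma branch_less: "branch p c d y l < 2 ^ l"
  by (induction l) (auto simp: branch_0 branch_Suc)

lemma prefix_code_leftmost: "prefix_code (leftmost p c d y) l = branch p c d y l"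
proof (induction l)
  case 0
  then show ?case by (simp add: prefix_code_def branch_0)
next
  case (Suc l)
  let ?a = "branch p c d y l"
  have "prefix_code (leftmost p c d y) (Suc l) = ?a + of_bool (bit (branch p c d y (Suc l)) l) * 2 ^ l"
    using Suc by (simp add: prefix_code_def leftmost_def)
  moreover have "\<not> bit ?a l" "bit (?a + 2 ^ l) l"
    using branch_less[of p c d y l] by (simp_all add: bit_iff_odd)
  ultimately show ?case by (simp add: branch_Suc)
qed

text \<open>
  Extending the string by one bit splits the image in two. If the approximation rejects the left half it is right
  to do so; if it accepts the left half, then \<open>y\<close> belongs to it because \<open>y\<close> is not misjudged.
\<close>

lemma image_upto_branch:
  assumes "\<And>n. image_upto p c 0 0 n y" and "y \<notin> misjudged p c d"
  shows "image_upto p c l (branch p c d y l) n y"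
proof (induction l arbitrary: n)
  case 0
  then show ?case using assms(1) by (simp add: branch_0)
next
  case (Suc l)
  let ?a = "branch p c d y l"
  show ?case
  proof (cases "image_upto p c (Suc l) ?a (depth p c d (Suc l) ?a) y")
    case True
    have "?a < 2 ^ Suc l" using branch_less[of p c d y l] by simp
    with True assms(2) have "image_upto p c (Suc l) ?a n y"
      unfolding misjudged_def by blast
    with True show ?thesis by (simp add: branch_Suc)
  next
    case False
    let ?n = "max n (depth p c d (Suc l) ?a)"
    have "\<not> image_upto p c (Suc l) ?a ?n y"
      using False image_upto_antimono max.cobounded2 by blast
    with image_upto_split[OF Suc[of ?n]] have "image_upto p c (Suc l) (?a + 2 ^ l) ?n y" by blast
    then have "image_upto p c (Suc l) (?a + 2 ^ l) n y"
      by (rule image_upto_antimono) simp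
    with False show ?thesis by (simp add: branch_Suc)
  qed
qed

text \<open>
  Taking the string as long as the use of the computation, the preimage of that string that witnesses membership
  can be replaced by the leftmost path itself.
\<close>

lemma outputs_leftmost:
  assumes "\<And>n. image_upto p c 0 0 n y" and "y \<notin> misjudged p c d"
  shows "outputs p (leftmost p c d y) (stage p c n) n y"
proof -
  let ?x = "leftmost p c d y" and ?t = "stage p c n"
  from image_upto_branch[OF assms, of ?t n]
  obtain x' where x': "prefix_code x' ?t = prefix_code ?x ?t" "outputs p x' ?t n y"
    unfolding image_upto_def prefix_code_leftmost by blast
  have "x' i = ?x i" if "i < ?t" for i
    using that x'(1) by (metis bit_prefix_code)
  then show ?thesis using x'(2) by (rule outputs_use)
qed

text \<open>
  Continuity of the path in \<open>y\<close>, from which the measurability of the set of inverted reals follows.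
\<close>

lemma leftmost_use: "\<exists>k. \<forall>y y'. (\<forall>i<k. y i = y' i) \<longrightarrow> branch p c d y l = branch p c d y' l"
proof (induction l)
  case 0
  then show ?case by (simp add: branch_0)
next
  case (Suc l)
  then obtain k where k: "\<And>y y'. (\<forall>i<k. y i = y' i) \<Longrightarrow> branch p c d y l = branch p c d y' l" by blast
  let ?k = "k + (\<Sum>a<2 ^ l. depth p c d (Suc l) a)"
  have "branch p c d y (Suc l) = branch p c d y' (Suc l)" if y: "\<forall>i<?k. y i = y' i" for y y'
  proof -
    let ?a = "branch p c d y l"
    let ?e = "depth p c d (Suc l) ?a"
    have a: "branch p c d y' l = ?a" by (rule k) (use y in simp)
    have "?e \<le> (\<Sum>a<2 ^ l. depth p c d (Suc l) a)"
      using branch_less[of p c d y l] by (intro member_le_sum) auto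
    then have "prefix_code y ?e = prefix_code y' ?e"
      using y by (intro prefix_code_cong) simp
    then have "image_upto p c (Suc l) ?a ?e y \<longleftrightarrow> image_upto p c (Suc l) ?a ?e y'"
      using determined_by_image_upto unfolding determined_by_def by metis
    then show ?thesis by (simp add: branch_Suc a)
  qed
  then show ?case by blast
qed

lemma sets_outputs_leftmost: "{y. outputs p (leftmost p c d y) t n y} \<in> sets coin_measure"
proof -
  obtain k where k: "\<And>y y'. (\<forall>i<k. y i = y' i) \<Longrightarrow> branch p c d y t = branch p c d y' t"
    using leftmost_use by blast
  have "determined_by (k + n) (\<lambda>y. outputs p (leftmost p c d y) t n y)"
  proof (rule determined_byI)
    fix y y' assume eq: "\<And>i. i < k + n \<Longrightarrow> y i = y' i" and out: "outputs p (leftmost p c d y) t n y"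
    have "prefix_code (leftmost p c d y) t = prefix_code (leftmost p c d y') t"
      unfolding prefix_code_leftmost using eq by (intro k) simp
    then have "leftmost p c d y i = leftmost p c d y' i" if "i < t" for i
      using that by (metis bit_prefix_code)
    then have "outputs p (leftmost p c d y') t n y" using out by (rule outputs_use)
    then show "outputs p (leftmost p c d y') t n y'"
      using eq by (intro outputs_cong[of n y y']) simp_all
  qed
  then show ?thesis by (rule sets_determined_by)
qed

lemma partial_computable_leftmost:
  "partial_computable_in (jump (jump empty_real)) (\<lambda>y. Some (leftmost p c d y))"
proof -
  let ?Z = "jump (jump empty_real)"
  let ?S = "range (\<lambda>y. join y ?Z)"
  note stage = computable_on_join[OF computable_in_jump[OF computable_stage]]
  note depth = computable_on_join[OF computable_depth]
  have depth': "computable_on ?S (\<lambda>A x. depth p c d (l A x) (a A x))"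
    if "computable_on ?S l" "computable_on ?S a" for l a
    by (rule computable_on_comp2[OF depth that])
  have "decidable_on ?S (\<lambda>A n. leftmost p c d (\<lambda>i. A (2 * i)) n)"
    unfolding leftmost_def branch_def
    by (intro computable computable_on_image_upto[OF stage] depth')
  then obtain q where "\<forall>A\<in>?S. \<forall>n. run A q n = Some (of_bool (leftmost p c d (\<lambda>i. A (2 * i)) n))"
    unfolding computable_on_def by blast
  then have q: "run (join y ?Z) q n = Some (of_bool (leftmost p c d y n))" for y n
    by (simp add: join_def)
  show ?thesis
    unfolding partial_computable_in_def halts_def
    by (rule exI[of _ q]) (simp add: q)
qed

theorem theorem2p11:
  fixes f :: "cantor \<rightharpoonup> cantor"
  assumes "partial_computable f"
    and "measure coin_measure {x \<in> dom f. the (f x) \<in> MLrandom} > 0"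
  shows "\<exists>g :: cantor \<rightharpoonup> cantor.
    partial_computable_in (jump (jump empty_real)) g \<and>
    measure coin_measure {y. (f \<circ>\<^sub>m g) y = Some y} > 0"
proof -
  let ?A = "{x \<in> dom f. the (f x) \<in> MLrandom}"
  from assms(1) obtain p where "computed_map f p"
    unfolding partial_computable_def computed_map_def by blast
  then interpret computed_map f p .
  have A: "?A \<in> sets coin_measure"
    using assms(2) measure_notin_sets by fastforce
  obtain c where c: "0 < measure coin_measure {y. \<forall>n. image_upto p c 0 0 n y}"
    using positive_measure_image[OF A _ _ assms(2)] by blast
  let ?F = "{y. \<forall>n. image_upto p c 0 0 n y}"
  obtain d where "(1 / 2) ^ d < measure coin_measure ?F / 2"
    using real_arch_pow_inv[of "measure coin_measure ?F / 2" "1 / 2"] c by auto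
  then have d: "2 / 2 ^ d < measure coin_measure ?F" by (simp add: power_one_over)
  let ?g = "\<lambda>y. Some (leftmost p c d y)"
  let ?I = "{y. (f \<circ>\<^sub>m ?g) y = Some y}"
  have I: "?I = {y. \<forall>n. \<exists>t. outputs p (leftmost p c d y) t n y}"
  proof (intro Collect_cong iffI)
    fix y assume "(f \<circ>\<^sub>m ?g) y = Some y"
    then have y: "f (leftmost p c d y) = Some y" by simp
    then have "leftmost p c d y \<in> dom f" by blast
    from ex_outputs[OF this] y show "\<forall>n. \<exists>t. outputs p (leftmost p c d y) t n y" by simp
  next
    fix y assume *: "\<forall>n. \<exists>t. outputs p (leftmost p c d y) t n y"
    then have dom: "leftmost p c d y \<in> dom f"
      unfolding dom_iff produces_iff by blast
    have "the (f (leftmost p c d y)) i = y i" for i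
      using *[rule_format, of "Suc i"] outputs_dom[OF dom] by blast
    then have "the (f (leftmost p c d y)) = y" by blast
    with dom show "(f \<circ>\<^sub>m ?g) y = Some y" by force
  qed
  have sets_I: "?I \<in> sets coin_measure"
  proof -
    have "?I = (\<Inter>n. \<Union>t. {y. outputs p (leftmost p c d y) t n y})"
      unfolding I by blast
    also have "\<dots> \<in> sets coin_measure"
      using sets_outputs_leftmost by auto
    finally show ?thesis .
  qed
  have F: "?F \<in> sets coin_measure"
    by (rule measure_decreasing_inter(1)[OF determined_by_image_upto]) (rule image_upto_antimono)
  have "?F \<subseteq> ?I \<union> misjudged p c d"
    unfolding I using outputs_leftmost by blast
  then have "measure coin_measure ?F \<le> measure coin_measure (?I \<union> misjudged p c d)"
    using sets_I measure_misjudged(1) by (intro coin.finite_measure_mono) auto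
  also have "\<dots> \<le> measure coin_measure ?I + measure coin_measure (misjudged p c d)"
    using sets_I measure_misjudged(1) by (intro measure_Un_le)
  finally have "0 < measure coin_measure ?I"
    using measure_misjudged(2)[of p c d] d by linarith
  with partial_computable_leftmost show ?thesis by blast
qed

end
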